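(* Let $0<\alpha<1$. Let $F_n$ be a consistent sequence of alternatives and let $F_{1n}$ be any inconsistent sequence of alternatives such that $F_{2n}(x)=F_n(x)+F_{1n}(x)-F_0(x)$ are distribution functions. Then for every sequence of Cramér–von Mises tests $K_n$ with $\alpha(K_n)=\alpha(1+o(1))$, $$\lim_{n\to\infty}\big(\beta_{F_n}(K_n)-\beta_{F_{2n}}(K_n)\big)=0 .$$
   Context: $X_1,\dots,X_n$ are i.i.d. with (Borel) distribution function $F$ on $[0,1]$, $\hat F_n$ is the empirical distribution function, $F_0(x)=x$, $H_0:F=F_0$, and $T^2(G)=\int_0^1G^2(x)dx$. A Cramér–von Mises test rejects $H_0$ iff $nT^2(\hat F_n-F_0)$ exceeds a threshold; $\alpha(K_n)$ is the type I error probability and $\beta_F(K_n)$ the type II error probability under $F$. A sequence of distribution functions $F_n$ is consistent if for every $\alpha\in(0,1)$ and every sequence of Cramér–von Mises tests $K_n$ with $\alpha(K_n)=\alpha(1+o(1))$, $\limsup_n\beta_{F_n}(K_n)<1-\alpha$; it is inconsistent if for every sequence of Cramér–von Mises tests $K_n$, $\liminf_n(\alpha(K_n)+\beta_{F_n}(K_n))\ge1$. *)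

theory Defs
  imports "HOL-Probability.Probability"
begin

text \<open>A (Borel) distribution on [0,1], represented by its probability law on the reals.
  Its distribution function is the library's cdf.\<close>
definition dist01 :: "real measure \<Rightarrow> bool" where
  "dist01 M \<longleftrightarrow> sets M = sets borel \<and> prob_space M \<and> emeasure M {0..1} = 1"

definition unif01 :: "real measure" where
  "unif01 = uniform_measure lborel {0..1}"

definition emp_df :: "nat \<Rightarrow> (nat \<Rightarrow> real) \<Rightarrow> real \<Rightarrow> real" where
  "emp_df n x t = real (card {i\<in>{..<n}. x i \<le> t}) / real n"

definition cvm_stat :: "nat \<Rightarrow> (nat \<Rightarrow> real) \<Rightarrow> real" where
  "cvm_stat n x = real n * integral {0..1} (\<lambda>t. (emp_df n x t - t)\<^sup>2)"

definition sample :: "real measure \<Rightarrow> nat \<Rightarrow> (nat \<Rightarrow> real) measure" where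
  "sample M n = PiM {..<n} (\<lambda>_. M)"

definition reject_prob :: "real measure \<Rightarrow> nat \<Rightarrow> real \<Rightarrow> real" where
  "reject_prob M n c = measure (sample M n) {x \<in> space (sample M n). cvm_stat n x > c}"

definition type1 :: "nat \<Rightarrow> real \<Rightarrow> real" where
  "type1 n c = reject_prob unif01 n c"

definition type2 :: "real measure \<Rightarrow> nat \<Rightarrow> real \<Rightarrow> real" where
  "type2 M n c = 1 - reject_prob M n c"

text \<open>A sequence of tests is given by its thresholds c n.\<close>
definition consistent_seq :: "(nat \<Rightarrow> real measure) \<Rightarrow> bool" where
  "consistent_seq F \<longleftrightarrow>
     (\<forall>a. 0 < a \<and> a < 1 \<longrightarrow>
        (\<forall>c :: nat \<Rightarrow> real. ((\<lambda>n. type1 n (c n) / a) \<longlonglongrightarrow> 1) \<longrightarrow>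
            limsup (\<lambda>n. ereal (type2 (F n) n (c n))) < ereal (1 - a)))"

definition inconsistent_seq :: "(nat \<Rightarrow> real measure) \<Rightarrow> bool" where
  "inconsistent_seq F \<longleftrightarrow>
     (\<forall>c :: nat \<Rightarrow> real. liminf (\<lambda>n. ereal (type1 n (c n) + type2 (F n) n (c n))) \<ge> 1)"

end

theory Submission
  imports Defs "HOL-Real_Asymp.Real_Asymp"
begin

text \<open>
  Norms are taken in \<open>L\<^sup>2\<close> of the unit interval, and \<open>T(G) = \<parallel>G\<parallel>\<close>, so the test statistic is
  \<open>\<parallel>\<surd>n (Fhat - F\<^sub>0)\<parallel>\<^sup>2\<close>. No central limit theorem is needed.

  \<^item> Quantile coupling: if two samples with laws \<open>M\<close> and \<open>N\<close> are generated from the same uniform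
    variables, the centred empirical processes differ in mean square by at most \<open>\<integral> |F\<^sub>M - F\<^sub>N|\<close>.
    Hence, up to an error that is small with \<open>\<integral> |F\<^sub>M - F\<^sub>N|\<close>, only the shift \<open>\<surd>n (F\<^sub>M - F\<^sub>0)\<close> matters.

  \<^item> Anti-concentration: tilting the uniform density by a factor \<open>1 \<plusminus> s / \<surd>n\<close> moves the process by
    \<open>s \<gamma>\<close> for a fixed \<open>\<gamma> \<noteq> 0\<close>, at a total variation cost of \<open>O(s)\<close> (a chi-square bound). As a function of \<open>s\<close>
    the squared norm is a quadratic with leading coefficient \<open>\<parallel>\<gamma>\<parallel>\<^sup>2\<close>, so among well separated values of
    \<open>s\<close> at most two can put it into a given short interval. Averaging over many values of \<open>s\<close>
    bounds the probability that the statistic falls into a short interval.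

  \<^item> Inconsistency forces \<open>n T\<^sup>2(F\<^sub>1\<^sub>n - F\<^sub>0) \<rightarrow> 0\<close>: the statistic has mean \<open>\<integral> F (1 - F) + n T\<^sup>2(F - F\<^sub>0)\<close>,
    it is asymptotically stochastically dominated by its null version, and a fourth moment bound
    makes this domination pass to the means.

  Consequently the shifts belonging to \<open>F\<^sub>n\<close> and \<open>F\<^sub>2\<^sub>n\<close> are asymptotically equal. Where
  \<open>n T\<^sup>2(F\<^sub>n - F\<^sub>0)\<close> is large both tests reject with probability close to one; where it is bounded, \<open>F\<^sub>n\<close> is close
  to \<open>F\<^sub>0\<close> and anti-concentration at the threshold applies.
\<close>

section \<open>Bounded Borel functions on the unit interval\<close>

lemma dist01_real_distribution: "dist01 M \<Longrightarrow> real_distribution M"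
  by (auto simp: dist01_def real_distribution_def real_distribution_axioms_def)

lemma sets_unif01 [measurable_cong, simp]: "sets unif01 = sets borel"
  by (simp add: unif01_def)

lemma space_unif01 [simp]: "space unif01 = UNIV"
  by (simp add: unif01_def)

lemma prob_space_unif01: "prob_space unif01"
  unfolding unif01_def by (rule prob_space_uniform_measure) auto

interpretation U: real_distribution unif01
  using prob_space_unif01 by (simp add: real_distribution_def real_distribution_axioms_def)

lemma AE_unif01: "AE t in unif01. 0 \<le> t \<and> t \<le> 1"
  unfolding unif01_def by (rule AE_uniform_measureI) auto

text \<open>\<open>F_0\<close> is represented throughout by \<open>cdf unif01\<close>. It is the
  identity only on the unit interval, but it stays bounded on the whole line, which \<open>t\<close>
  itself does not.\<close>

lemma cdf_unif01: "0 \<le> t \<Longrightarrow> t \<le> 1 \<Longrightarrow> cdf unif01 t = t"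
proof -
  assume t: "0 \<le> t" "t \<le> 1"
  have "{0..1} \<inter> {..t} = {0..t}" using t by auto
  then show ?thesis using t by (simp add: cdf_def unif01_def)
qed

text \<open>A class closed under sums, products and powers whose members are all integrable under
  \<open>unif01\<close>; it takes care of the integrability conditions for functions of
  \<open>t\<close>.\<close>

definition bdd_borel :: "(real \<Rightarrow> real) \<Rightarrow> bool" where
  "bdd_borel f \<longleftrightarrow> f \<in> borel_measurable borel \<and> (\<exists>B. \<forall>t. \<bar>f t\<bar> \<le> B)"

lemma bdd_borel_measurable [measurable_dest]: "bdd_borel f \<Longrightarrow> f \<in> borel_measurable borel"
  by (simp add: bdd_borel_def)

lemma bdd_borelI: "f \<in> borel_measurable borel \<Longrightarrow> (\<And>t. \<bar>f t\<bar> \<le> B) \<Longrightarrow> bdd_borel f"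
  by (auto simp: bdd_borel_def)

lemma bdd_borel_const [simp, intro]: "bdd_borel (\<lambda>_. c)"
  by (rule bdd_borelI[of _ "\<bar>c\<bar>"]) auto

lemma bdd_borel_add [intro]:
  assumes "bdd_borel f" "bdd_borel g" shows "bdd_borel (\<lambda>t. f t + g t)"
proof -
  obtain B C where "\<And>t. \<bar>f t\<bar> \<le> B" "\<And>t. \<bar>g t\<bar> \<le> C" using assms by (auto simp: bdd_borel_def)
  then have "\<bar>f t + g t\<bar> \<le> B + C" for t by (meson abs_triangle_ineq add_mono order_trans)
  with assms show ?thesis by (intro bdd_borelI) auto
qed

lemma bdd_borel_mult [intro]:
  assumes "bdd_borel f" "bdd_borel g" shows "bdd_borel (\<lambda>t. f t * g t)"
proof -
  obtain B C where *: "\<And>t. \<bar>f t\<bar> \<le> B" "\<And>t. \<bar>g t\<bar> \<le> C" using assms by (auto simp: bdd_borel_def)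
  have "\<bar>f t * g t\<bar> \<le> B * C" for t
    unfolding abs_mult by (intro mult_mono * abs_ge_zero order_trans[OF abs_ge_zero *(1)])
  with assms show ?thesis by (intro bdd_borelI) auto
qed

lemma bdd_borel_diff [intro]:
  assumes "bdd_borel f" "bdd_borel g" shows "bdd_borel (\<lambda>t. f t - g t)"
  using bdd_borel_add[OF assms(1) bdd_borel_mult[OF bdd_borel_const[of "-1"] assms(2)]] by simp

lemma bdd_borel_divide [intro]: "bdd_borel f \<Longrightarrow> bdd_borel (\<lambda>t. f t / c)"
  using bdd_borel_mult[OF _ bdd_borel_const[of "inverse c"]] by (simp add: divide_inverse)

lemma bdd_borel_power [intro]: "bdd_borel f \<Longrightarrow> bdd_borel (\<lambda>t. f t ^ k)"
  by (induction k) auto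

lemma bdd_borel_abs [intro]: "bdd_borel f \<Longrightarrow> bdd_borel (\<lambda>t. \<bar>f t\<bar>)"
  by (auto simp: bdd_borel_def)

lemma bdd_borel_sum [intro]:
  "finite I \<Longrightarrow> (\<And>i. i \<in> I \<Longrightarrow> bdd_borel (f i)) \<Longrightarrow> bdd_borel (\<lambda>t. \<Sum>i\<in>I. f i t)"
  by (induction I rule: finite_induct) auto

lemma bdd_borel_cdf: "real_distribution M \<Longrightarrow> bdd_borel (cdf M)"
proof -
  assume "real_distribution M"
  then interpret cdf_distribution M by (simp add: cdf_distribution_def)
  show ?thesis
    by (rule bdd_borelI[of _ 1]) (auto simp: cdf_nonneg cdf_bounded_prob)
qed

lemma bdd_borel_integrable: "bdd_borel f \<Longrightarrow> integrable unif01 f"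
  by (auto simp: bdd_borel_def intro!: U.integrable_const_bound[OF AE_I2])

section \<open>The \<open>L^2\<close> norm of the uniform law\<close>

definition l2norm :: "(real \<Rightarrow> real) \<Rightarrow> real" where
  "l2norm f = sqrt (\<integral>t. (f t)\<^sup>2 \<partial>unif01)"

lemma l2norm_nonneg [simp]: "0 \<le> l2norm f"
  by (simp add: l2norm_def)

lemma l2norm_sq: "(l2norm f)\<^sup>2 = (\<integral>t. (f t)\<^sup>2 \<partial>unif01)"
  by (simp add: l2norm_def)

lemma l2norm_scale: "l2norm (\<lambda>t. c * f t) = \<bar>c\<bar> * l2norm f"
  by (simp add: l2norm_def power_mult_distrib real_sqrt_mult)

lemma l2norm_uminus: "l2norm (\<lambda>t. - f t) = l2norm f"
  by (simp add: l2norm_def)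

lemma l2norm_add_sq:
  assumes "bdd_borel f" "bdd_borel g"
  shows "(l2norm (\<lambda>t. f t + g t))\<^sup>2 = (l2norm f)\<^sup>2 + 2 * (\<integral>t. f t * g t \<partial>unif01) + (l2norm g)\<^sup>2"
proof -
  have [simp]: "integrable unif01 (\<lambda>t. (f t)\<^sup>2)" "integrable unif01 (\<lambda>t. (g t)\<^sup>2)"
    "integrable unif01 (\<lambda>t. f t * g t)"
    using assms by (auto intro!: bdd_borel_integrable)
  have "(f t + g t)\<^sup>2 = ((f t)\<^sup>2 + 2 * (f t * g t)) + (g t)\<^sup>2" for t
    by (simp add: power2_sum)
  then show ?thesis by (simp add: l2norm_sq)
qed

text \<open>The squared norm of \<open>f + c g\<close> is a nonnegative quadratic in
  \<open>c\<close>; evaluating it at a suitable \<open>c\<close> bounds the linear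
  coefficient.\<close>

lemma cauchy_schwarz_unif01:
  assumes f: "bdd_borel f" and g: "bdd_borel g"
  shows "(\<integral>t. f t * g t \<partial>unif01) \<le> l2norm f * l2norm g"
proof -
  let ?I = "\<integral>t. f t * g t \<partial>unif01"
  have q: "0 \<le> (l2norm f)\<^sup>2 + 2 * (c * ?I) + (\<bar>c\<bar> * l2norm g)\<^sup>2" for c
  proof -
    have "(l2norm f)\<^sup>2 + 2 * (\<integral>t. f t * (c * g t) \<partial>unif01) + (l2norm (\<lambda>t. c * g t))\<^sup>2 \<ge> 0"
      using f g by (subst l2norm_add_sq[symmetric]) auto
    moreover have "(\<integral>t. f t * (c * g t) \<partial>unif01) = c * ?I"
      by (subst integral_mult_right_zero[symmetric]) (simp add: ac_simps)
    ultimately show ?thesis by (simp add: l2norm_scale)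
  qed
  have "?I\<^sup>2 \<le> (l2norm f * l2norm g)\<^sup>2"
  proof (cases "l2norm g = 0")
    case True
    have "?I = 0"
    proof (rule ccontr)
      assume "?I \<noteq> 0"
      \<comment> \<open>For \<open>l2norm g = 0\<close> the quadratic is affine in \<open>c\<close>;
        this \<open>c\<close> would give it the value -1.\<close>
      then have "(- ((l2norm f)\<^sup>2 + 1) / (2 * ?I)) * ?I = - ((l2norm f)\<^sup>2 + 1) / 2" by simp
      then show False using q[of "- ((l2norm f)\<^sup>2 + 1) / (2 * ?I)"] True by simp
    qed
    then show ?thesis by simp
  next
    case False
    \<comment> \<open>The choice \<open>c = - ?I / (l2norm g)^2\<close> minimises the
      quadratic.\<close>
    then have "(\<bar>- ?I / (l2norm g)\<^sup>2\<bar> * l2norm g)\<^sup>2 = ?I\<^sup>2 / (l2norm g)\<^sup>2"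
      by (simp add: field_simps power2_eq_square)
    moreover have "(- ?I / (l2norm g)\<^sup>2) * ?I = - (?I\<^sup>2 / (l2norm g)\<^sup>2)"
      by (simp add: power2_eq_square)
    ultimately have "0 \<le> (l2norm f)\<^sup>2 - ?I\<^sup>2 / (l2norm g)\<^sup>2"
      using q[of "- ?I / (l2norm g)\<^sup>2"] by linarith
    then show ?thesis using False by (simp add: field_simps power_mult_distrib)
  qed
  then show ?thesis by (rule power2_le_imp_le) simp
qed

lemma l2norm_triangle:
  assumes "bdd_borel f" "bdd_borel g"
  shows "l2norm (\<lambda>t. f t + g t) \<le> l2norm f + l2norm g"
proof (rule power2_le_imp_le)
  show "(l2norm (\<lambda>t. f t + g t))\<^sup>2 \<le> (l2norm f + l2norm g)\<^sup>2"
    using cauchy_schwarz_unif01[OF assms] by (simp add: l2norm_add_sq[OF assms] power2_sum)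
qed simp

lemma l2norm_diff_le:
  assumes "bdd_borel f" "bdd_borel g"
  shows "\<bar>l2norm f - l2norm g\<bar> \<le> l2norm (\<lambda>t. f t - g t)"
proof -
  have "l2norm f \<le> l2norm (\<lambda>t. f t - g t) + l2norm g"
    using l2norm_triangle[of "\<lambda>t. f t - g t" g] assms by (simp add: bdd_borel_diff)
  moreover have "l2norm g \<le> l2norm f + l2norm (\<lambda>t. - (f t - g t))"
    using l2norm_triangle[of f "\<lambda>t. - (f t - g t)"] assms by (simp add: bdd_borel_diff)
  ultimately show ?thesis unfolding l2norm_uminus by linarith
qed

lemma integral_abs_le_l2norm:
  assumes "bdd_borel f"
  shows "(\<integral>t. \<bar>f t\<bar> \<partial>unif01) \<le> l2norm f"
proof -
  have "(\<integral>t. \<bar>f t\<bar> * 1 \<partial>unif01) \<le> l2norm (\<lambda>t. \<bar>f t\<bar>) * l2norm (\<lambda>_. 1)"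
    using assms by (intro cauchy_schwarz_unif01) auto
  then show ?thesis using U.prob_space by (simp add: l2norm_def)
qed

lemma power2_integral_le:
  assumes "bdd_borel f"
  shows "(\<integral>t. f t \<partial>unif01)\<^sup>2 \<le> (\<integral>t. (f t)\<^sup>2 \<partial>unif01)"
proof -
  have "\<bar>\<integral>t. f t \<partial>unif01\<bar> \<le> (\<integral>t. \<bar>f t\<bar> \<partial>unif01)" by simp
  also have "\<dots> \<le> l2norm f" using assms by (rule integral_abs_le_l2norm)
  finally have "\<bar>\<integral>t. f t \<partial>unif01\<bar>\<^sup>2 \<le> (l2norm f)\<^sup>2" by (intro power_mono) auto
  then show ?thesis by (simp add: l2norm_sq)
qed

text \<open>Connects the gauge integral in \<open>cvm_stat\<close> with the Lebesgue integral. The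
  bound is asked for on the unit interval only, because the integrand there contains the unbounded
  function \<open>t\<close>.\<close>

lemma integral_unif01_eq:
  fixes f :: "real \<Rightarrow> real"
  assumes [measurable]: "f \<in> borel_measurable borel" and B: "\<And>t. 0 \<le> t \<Longrightarrow> t \<le> 1 \<Longrightarrow> \<bar>f t\<bar> \<le> B"
  shows "integral {0..1} f = (\<integral>t. f t \<partial>unif01)"
proof -
  have si: "set_integrable lborel {0..1} f"
    unfolding set_integrable_def
    by (rule integrableI_bounded_set_indicator[where B = B]) (use B in auto)
  have dens: "unif01 = density lborel (\<lambda>t. ennreal (indicator {0..1} t))"
    unfolding unif01_def uniform_measure_def by (intro density_cong) (auto simp: indicator_def)
  have "(\<integral>t. f t \<partial>unif01) = (\<integral>t. indicator {0..1} t *\<^sub>R f t \<partial>lborel)"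
    by (subst dens) (auto simp: integral_density)
  also have "\<dots> = integral {0..1} f"
    using set_borel_integral_eq_integral(2)[OF si] by (simp add: set_lebesgue_integral_def)
  finally show ?thesis by simp
qed

section \<open>Moments of sums over independent samples\<close>

lemma prob_space_PiM_const: "prob_space \<Omega> \<Longrightarrow> prob_space (PiM I (\<lambda>_. \<Omega>))"
  by (intro prob_space_PiM)

lemma (in prob_space) integrable_bounded:
  fixes f :: "'a \<Rightarrow> real"
  shows "f \<in> borel_measurable M \<Longrightarrow> (\<And>x. x \<in> space M \<Longrightarrow> \<bar>f x\<bar> \<le> B) \<Longrightarrow> integrable M f"
  by (rule integrable_const_bound[of _ B]) auto

lemma abs_power_le:
  fixes z :: real
  shows "\<bar>z\<bar> \<le> B \<Longrightarrow> \<bar>z ^ k\<bar> \<le> B ^ k"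
  by (simp add: power_abs power_mono)

lemma abs_sum_le_card:
  fixes f :: "'a \<Rightarrow> real" and n :: nat
  assumes "\<And>\<omega>. \<omega> \<in> space \<Omega> \<Longrightarrow> \<bar>f \<omega>\<bar> \<le> B" "x \<in> space (PiM {..<n} (\<lambda>_. \<Omega>))"
  shows "\<bar>\<Sum>i<n. f (x i)\<bar> \<le> real n * B"
proof -
  have "\<bar>\<Sum>i<n. f (x i)\<bar> \<le> (\<Sum>i<n. \<bar>f (x i)\<bar>)" by (rule sum_abs)
  also have "\<dots> \<le> (\<Sum>i<n. B)"
    using assms by (intro sum_mono) (auto simp: space_PiM)
  finally show ?thesis by simp
qed

text \<open>Fubini splits off the last observation; this is the induction step for the moments
  below. The bound on \<open>h\<close> is required only on the range of the sum, so that powers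
  qualify.\<close>

lemma integral_PiM_Suc:
  fixes h :: "real \<Rightarrow> real" and n :: nat
  assumes "prob_space \<Omega>" and [measurable]: "f \<in> borel_measurable \<Omega>" "h \<in> borel_measurable borel"
    and f: "\<And>\<omega>. \<omega> \<in> space \<Omega> \<Longrightarrow> \<bar>f \<omega>\<bar> \<le> B"
    and h: "\<And>s. \<bar>s\<bar> \<le> real (Suc n) * B \<Longrightarrow> \<bar>h s\<bar> \<le> C"
  shows "(\<integral>x. h (\<Sum>i<Suc n. f (x i)) \<partial>PiM {..<Suc n} (\<lambda>_. \<Omega>)) =
    (\<integral>x. (\<integral>y. h ((\<Sum>i<n. f (x i)) + f y) \<partial>\<Omega>) \<partial>PiM {..<n} (\<lambda>_. \<Omega>))"
proof -
  interpret \<Omega>: prob_space \<Omega> by fact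
  interpret product_prob_space "\<lambda>_::nat. \<Omega>" by unfold_locales
  interpret Pn: prob_space "PiM (insert n {..<n}) (\<lambda>_. \<Omega>)" by (intro prob_space_PiM_const assms)
  have "integrable (PiM (insert n {..<n}) (\<lambda>_. \<Omega>)) (\<lambda>x. h (\<Sum>i<Suc n. f (x i)))"
  proof (rule Pn.integrable_bounded)
    show "(\<lambda>x. h (\<Sum>i<Suc n. f (x i))) \<in> borel_measurable (PiM (insert n {..<n}) (\<lambda>_. \<Omega>))"
      by measurable auto
    fix x assume "x \<in> space (PiM (insert n {..<n}) (\<lambda>_. \<Omega>))"
    then show "\<bar>h (\<Sum>i<Suc n. f (x i))\<bar> \<le> C"
      by (intro h abs_sum_le_card[OF f]) (auto simp: lessThan_Suc)
  qed
  from product_integral_insert[OF _ _ this]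
  show ?thesis by (simp add: lessThan_Suc add.commute)
qed

lemma integral_iid_sum_power2:
  fixes n :: nat
  assumes "prob_space \<Omega>" and [measurable]: "f \<in> borel_measurable \<Omega>"
    and f: "\<And>\<omega>. \<omega> \<in> space \<Omega> \<Longrightarrow> \<bar>f \<omega>\<bar> \<le> B" and f0: "(\<integral>\<omega>. f \<omega> \<partial>\<Omega>) = 0"
  shows "(\<integral>x. (\<Sum>i<n. f (x i))\<^sup>2 \<partial>PiM {..<n} (\<lambda>_. \<Omega>)) = real n * (\<integral>\<omega>. (f \<omega>)\<^sup>2 \<partial>\<Omega>)"
proof (induction n)
  case 0 then show ?case by simp
next
  case (Suc n)
  interpret \<Omega>: prob_space \<Omega> by fact
  interpret P: prob_space "PiM {..<n} (\<lambda>_. \<Omega>)" by (intro prob_space_PiM_const assms)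
  have [simp]: "integrable \<Omega> f" by (rule \<Omega>.integrable_bounded[OF _ f]) auto
  have [simp]: "integrable \<Omega> (\<lambda>\<omega>. (f \<omega>)\<^sup>2)"
    by (rule \<Omega>.integrable_bounded[OF _ abs_power_le[OF f]]) auto
  have [simp]: "integrable (PiM {..<n} (\<lambda>_. \<Omega>)) (\<lambda>x. (\<Sum>i<n. f (x i))\<^sup>2)"
    by (rule P.integrable_bounded[OF _ abs_power_le[OF abs_sum_le_card[OF f]]]) auto
  have "(\<integral>x. (\<Sum>i<Suc n. f (x i))\<^sup>2 \<partial>PiM {..<Suc n} (\<lambda>_. \<Omega>)) =
    (\<integral>x. (\<integral>y. ((\<Sum>i<n. f (x i)) + f y)\<^sup>2 \<partial>\<Omega>) \<partial>PiM {..<n} (\<lambda>_. \<Omega>))"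
    by (rule integral_PiM_Suc[OF assms(1) _ _ f abs_power_le]) auto
  also have "\<dots> = (\<integral>x. (\<Sum>i<n. f (x i))\<^sup>2 + (\<integral>\<omega>. (f \<omega>)\<^sup>2 \<partial>\<Omega>) \<partial>PiM {..<n} (\<lambda>_. \<Omega>))"
    by (intro Bochner_Integration.integral_cong) (simp_all add: power2_sum f0 \<Omega>.prob_space)
  also have "\<dots> = real (Suc n) * (\<integral>\<omega>. (f \<omega>)\<^sup>2 \<partial>\<Omega>)"
    by (simp add: Suc P.prob_space algebra_simps)
  finally show ?case .
qed

lemma integral_iid_sum:
  fixes n :: nat and f :: "'a \<Rightarrow> real"
  assumes "prob_space \<Omega>" and [measurable]: "f \<in> borel_measurable \<Omega>"
    and f: "\<And>\<omega>. \<omega> \<in> space \<Omega> \<Longrightarrow> \<bar>f \<omega>\<bar> \<le> B" and f0: "(\<integral>\<omega>. f \<omega> \<partial>\<Omega>) = 0"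
  shows "(\<integral>x. (\<Sum>i<n. f (x i)) \<partial>PiM {..<n} (\<lambda>_. \<Omega>)) = 0"
proof (induction n)
  case 0 then show ?case by simp
next
  case (Suc n)
  interpret \<Omega>: prob_space \<Omega> by fact
  have [simp]: "integrable \<Omega> f" by (rule \<Omega>.integrable_bounded[OF _ f]) auto
  have "(\<integral>x. (\<Sum>i<Suc n. f (x i)) \<partial>PiM {..<Suc n} (\<lambda>_. \<Omega>)) =
    (\<integral>x. (\<integral>y. ((\<Sum>i<n. f (x i)) + f y) \<partial>\<Omega>) \<partial>PiM {..<n} (\<lambda>_. \<Omega>))"
    by (rule integral_PiM_Suc[OF assms(1) _ _ f, where h = "\<lambda>x. x"]) auto
  also have "\<dots> = 0" by (simp add: f0 \<Omega>.prob_space Suc)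
  finally show ?case .
qed

text \<open>In the binomial expansion the terms with coefficient 4 vanish: one contains the mean of
  \<open>f\<close>, the other the mean of the partial sum. The remaining increment is at most
  \<open>6 n + 1\<close>.\<close>

lemma integral_iid_sum_power4_le:
  fixes n :: nat
  assumes "prob_space \<Omega>" and [measurable]: "f \<in> borel_measurable \<Omega>"
    and f: "\<And>\<omega>. \<omega> \<in> space \<Omega> \<Longrightarrow> \<bar>f \<omega>\<bar> \<le> 1" and f0: "(\<integral>\<omega>. f \<omega> \<partial>\<Omega>) = 0"
  shows "(\<integral>x. (\<Sum>i<n. f (x i)) ^ 4 \<partial>PiM {..<n} (\<lambda>_. \<Omega>)) \<le> 3 * (real n)\<^sup>2"
proof (induction n)
  case 0 then show ?case by simp
next
  case (Suc n)
  interpret \<Omega>: prob_space \<Omega> by fact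
  let ?P = "PiM {..<n} (\<lambda>_. \<Omega>)"
  interpret P: prob_space ?P by (intro prob_space_PiM_const assms)
  define m where "m k = (\<integral>\<omega>. f \<omega> ^ k \<partial>\<Omega>)" for k
  have fk: "\<bar>f \<omega> ^ k\<bar> \<le> 1" if "\<omega> \<in> space \<Omega>" for \<omega> k
    using power_mono[OF f[OF that], of k] by (simp add: power_abs)
  have int_f: "integrable \<Omega> (\<lambda>\<omega>. f \<omega> ^ k)" for k
    by (rule \<Omega>.integrable_bounded[OF _ fk]) auto
  have int_S: "integrable ?P (\<lambda>x. (\<Sum>i<n. f (x i)) ^ k)" for k
    by (rule P.integrable_bounded[OF _ abs_power_le[OF abs_sum_le_card[OF f]]]) auto
  have m_le: "m k \<le> 1" for k
    unfolding m_def using fk by (intro \<Omega>.integral_le_const int_f AE_I2) (auto dest: abs_le_D1)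
  have m1: "m 1 = 0" using f0 by (simp add: m_def)
  have "(\<integral>x. (\<Sum>i<Suc n. f (x i)) ^ 4 \<partial>PiM {..<Suc n} (\<lambda>_. \<Omega>)) =
    (\<integral>x. (\<integral>y. ((\<Sum>i<n. f (x i)) + f y) ^ 4 \<partial>\<Omega>) \<partial>?P)"
    by (rule integral_PiM_Suc[OF assms(1) _ _ f abs_power_le]) auto
  also have "\<dots> = (\<integral>x. (\<Sum>i<n. f (x i)) ^ 4 + 6 * m 2 * (\<Sum>i<n. f (x i))\<^sup>2 +
      4 * m 3 * (\<Sum>i<n. f (x i)) ^ 1 + m 4 \<partial>?P)"
  proof (intro Bochner_Integration.integral_cong refl)
    fix x
    let ?s = "\<Sum>i<n. f (x i)"
    have e: "(?s + f y) ^ 4 = ?s ^ 4 + 4 * ?s ^ 3 * f y ^ 1 + 6 * ?s\<^sup>2 * (f y)\<^sup>2 + 4 * ?s * f y ^ 3 + f y ^ 4" for y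
      by (simp add: power4_eq_xxxx power3_eq_cube power2_eq_square algebra_simps)
    show "(\<integral>y. (?s + f y) ^ 4 \<partial>\<Omega>) = ?s ^ 4 + 6 * m 2 * ?s\<^sup>2 + 4 * m 3 * ?s ^ 1 + m 4"
      unfolding e using int_f m1
      by (simp add: m_def \<Omega>.prob_space int_f[of 1, simplified])
  qed
  also have "\<dots> = (\<integral>x. (\<Sum>i<n. f (x i)) ^ 4 \<partial>?P) + 6 * m 2 * (\<integral>x. (\<Sum>i<n. f (x i))\<^sup>2 \<partial>?P) +
      4 * m 3 * (\<integral>x. (\<Sum>i<n. f (x i)) \<partial>?P) + m 4"
    using int_S int_S[of 1] by (simp add: P.prob_space)
  also have "\<dots> = (\<integral>x. (\<Sum>i<n. f (x i)) ^ 4 \<partial>?P) + 6 * real n * (m 2)\<^sup>2 + m 4"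
    using integral_iid_sum_power2[OF assms, of n] integral_iid_sum[OF assms, of n]
    by (simp add: m_def power2_eq_square)
  also have "\<dots> \<le> 3 * (real n)\<^sup>2 + 6 * real n * 1 + 1"
  proof (intro add_mono Suc mult_left_mono m_le)
    have "0 \<le> m 2" unfolding m_def by (intro Bochner_Integration.integral_nonneg) auto
    then show "(m 2)\<^sup>2 \<le> 1" using m_le[of 2] by (simp add: power_le_one)
  qed auto
  \<comment> \<open>The right-hand side grows by \<open>6 n + 3\<close> from \<open>n\<close> to
    \<open>Suc n\<close>.\<close>
  also have "\<dots> \<le> 3 * (real (Suc n))\<^sup>2" by (simp add: power2_eq_square algebra_simps)
  finally show ?case .
qed

text \<open>\<open>\<psi> \<omega> t\<close> is the centred contribution of a single observation at the point \<open>t\<close>.\<close>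

locale centred_kernel = prob_space \<Omega> for \<Omega> :: "'a measure" +
  fixes \<psi> :: "'a \<Rightarrow> real \<Rightarrow> real"
  assumes \<psi>_measurable [measurable]: "case_prod \<psi> \<in> borel_measurable (\<Omega> \<Otimes>\<^sub>M borel)"
    and \<psi>_bound: "\<And>\<omega> t. \<omega> \<in> space \<Omega> \<Longrightarrow> \<bar>\<psi> \<omega> t\<bar> \<le> 1"
    and \<psi>_centred: "\<And>t. (\<integral>\<omega>. \<psi> \<omega> t \<partial>\<Omega>) = 0"
begin

abbreviation S :: "nat \<Rightarrow> (nat \<Rightarrow> 'a) \<Rightarrow> real \<Rightarrow> real" where
  "S n x t \<equiv> (\<Sum>i<n. \<psi> (x i) t)"

abbreviation P :: "nat \<Rightarrow> (nat \<Rightarrow> 'a) measure" where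
  "P n \<equiv> PiM {..<n} (\<lambda>_. \<Omega>)"

lemma \<psi>_measurable_1 [measurable]: "(\<lambda>\<omega>. \<psi> \<omega> t) \<in> borel_measurable \<Omega>"
  using measurable_compose[OF measurable_Pair2'[of t borel \<Omega>] \<psi>_measurable] by simp

lemma S_measurable [measurable]: "case_prod (S n) \<in> borel_measurable (P n \<Otimes>\<^sub>M borel)"
proof -
  have "(\<lambda>z. \<psi> (fst z i) (snd z)) \<in> borel_measurable (P n \<Otimes>\<^sub>M borel)" if "i < n" for i
  proof -
    have "(\<lambda>z. (fst z i, snd z)) \<in> P n \<Otimes>\<^sub>M borel \<rightarrow>\<^sub>M \<Omega> \<Otimes>\<^sub>M (borel :: real measure)"
      using that by (intro measurable_Pair measurable_compose[OF measurable_fst] measurable_component_singleton) auto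
    from measurable_compose[OF this \<psi>_measurable] show ?thesis by simp
  qed
  then show ?thesis by (auto simp: split_beta intro!: borel_measurable_sum)
qed

lemma S_bound: "x \<in> space (P n) \<Longrightarrow> \<bar>S n x t\<bar> \<le> real n"
  using abs_sum_le_card[of \<Omega> "\<lambda>\<omega>. \<psi> \<omega> t" 1 x n] \<psi>_bound by simp

lemma prob_space_P: "prob_space (P n)"
  by (intro prob_space_PiM prob_space_axioms)

lemma bdd_borel_S: "x \<in> space (P n) \<Longrightarrow> bdd_borel (S n x)"
proof (rule bdd_borelI[OF _ S_bound])
  show "x \<in> space (P n) \<Longrightarrow> S n x \<in> borel_measurable borel"
    using measurable_compose[OF measurable_Pair1'[of x "P n" borel] S_measurable] by simp
qed

text \<open>The power and the weight allow one exchange of integrals to serve the square, the cross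
  term with a shift, and the fourth moment.\<close>

lemma S_power_mult_fubini:
  assumes w: "bdd_borel w"
  shows "(\<integral>x. (\<integral>t. S n x t ^ k * w t \<partial>unif01) \<partial>P n) = (\<integral>t. (\<integral>x. S n x t ^ k \<partial>P n) * w t \<partial>unif01)"
    and "integrable (P n) (\<lambda>x. \<integral>t. S n x t ^ k * w t \<partial>unif01)"
    and "integrable unif01 (\<lambda>t. (\<integral>x. S n x t ^ k \<partial>P n) * w t)"
proof -
  interpret P: prob_space "P n" by (rule prob_space_P)
  interpret PU: pair_prob_space "P n" unif01 by unfold_locales
  note bdd_borel_measurable[OF w, measurable]
  obtain C where C: "\<And>t. \<bar>w t\<bar> \<le> C" using w by (auto simp: bdd_borel_def)
  have m: "case_prod (S n) \<in> borel_measurable (P n \<Otimes>\<^sub>M unif01)"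
    using S_measurable[of n] by (simp cong: measurable_cong_sets sets_pair_measure_cong)
  have int: "integrable (P n \<Otimes>\<^sub>M unif01) (\<lambda>(x, t). S n x t ^ k * w t)"
  proof (rule PU.integrable_bounded)
    show "(\<lambda>(x, t). S n x t ^ k * w t) \<in> borel_measurable (P n \<Otimes>\<^sub>M unif01)"
      using m by (simp add: split_beta)
    fix z assume "z \<in> space (P n \<Otimes>\<^sub>M unif01)"
    then have "\<bar>S n (fst z) (snd z)\<bar> ^ k * \<bar>w (snd z)\<bar> \<le> real n ^ k * C"
      by (intro mult_mono power_mono S_bound C) (auto simp: space_pair_measure)
    then show "\<bar>case z of (x, t) \<Rightarrow> S n x t ^ k * w t\<bar> \<le> real n ^ k * C"
      by (simp add: split_beta abs_mult power_abs)
  qed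
  show "(\<integral>x. (\<integral>t. S n x t ^ k * w t \<partial>unif01) \<partial>P n) = (\<integral>t. (\<integral>x. S n x t ^ k \<partial>P n) * w t \<partial>unif01)"
    using PU.Fubini_integral[OF int] by simp
  show "integrable (P n) (\<lambda>x. \<integral>t. S n x t ^ k * w t \<partial>unif01)"
    using PU.integrable_fst'[OF int] by simp
  show "integrable unif01 (\<lambda>t. (\<integral>x. S n x t ^ k \<partial>P n) * w t)"
    using PU.integrable_snd[OF int] by simp
qed

text \<open>Bias-variance decomposition: the cross term is an integral of means of \<open>S\<close>,
  hence zero. For the indicator kernel it yields the mean of the test statistic; for the coupling
  kernel, with \<open>w = 0\<close>, the mean square distance of two processes.\<close>

lemma l2norm_S_add_sq:
  assumes w: "bdd_borel w" and n: "n > 0"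
  shows "(\<integral>x. (l2norm (\<lambda>t. S n x t / sqrt (real n) + w t))\<^sup>2 \<partial>P n) =
      (\<integral>t. (\<integral>\<omega>. (\<psi> \<omega> t)\<^sup>2 \<partial>\<Omega>) \<partial>unif01) + (l2norm w)\<^sup>2"
    and "integrable (P n) (\<lambda>x. (l2norm (\<lambda>t. S n x t / sqrt (real n) + w t))\<^sup>2)"
proof -
  interpret P: prob_space "P n" by (rule prob_space_P)
  let ?r = "sqrt (real n)"
  \<comment> \<open>The factors \<open>* 1\<close> and \<open>^ 1\<close> match the form of
    \<open>S_power_mult_fubini\<close>.\<close>
  have eq: "(l2norm (\<lambda>t. S n x t / ?r + w t))\<^sup>2 =
     (\<integral>t. S n x t ^ 2 * 1 \<partial>unif01) / real n + 2 / ?r * (\<integral>t. S n x t ^ 1 * w t \<partial>unif01) + (l2norm w)\<^sup>2"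
    if "x \<in> space (P n)" for x
  proof -
    have "(l2norm (\<lambda>t. S n x t / ?r))\<^sup>2 = (\<integral>t. S n x t ^ 2 * 1 \<partial>unif01) / real n"
      by (simp add: l2norm_sq power_divide)
    then show ?thesis
      using bdd_borel_S[OF that] w by (subst l2norm_add_sq) auto
  qed
  note F2 = S_power_mult_fubini[OF bdd_borel_const[of 1], of n 2]
    and F1 = S_power_mult_fubini[OF w, of n 1]
  have 2: "(\<integral>x. S n x t ^ 2 \<partial>P n) = real n * (\<integral>\<omega>. (\<psi> \<omega> t)\<^sup>2 \<partial>\<Omega>)" for t
    by (rule integral_iid_sum_power2[where B = 1]) (auto intro: prob_space_axioms \<psi>_bound \<psi>_centred)
  have 1: "(\<integral>x. S n x t ^ 1 \<partial>P n) = 0" for t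
    using integral_iid_sum[of \<Omega> "\<lambda>\<omega>. \<psi> \<omega> t" 1 n] prob_space_axioms \<psi>_bound \<psi>_centred by simp
  have "(\<integral>x. (l2norm (\<lambda>t. S n x t / ?r + w t))\<^sup>2 \<partial>P n) =
     (\<integral>x. (\<integral>t. S n x t ^ 2 * 1 \<partial>unif01) / real n + 2 / ?r * (\<integral>t. S n x t ^ 1 * w t \<partial>unif01) + (l2norm w)\<^sup>2 \<partial>P n)"
    by (intro Bochner_Integration.integral_cong eq refl)
  also have "\<dots> = (\<integral>x. (\<integral>t. S n x t ^ 2 * 1 \<partial>unif01) \<partial>P n) / real n +
      2 / ?r * (\<integral>x. (\<integral>t. S n x t ^ 1 * w t \<partial>unif01) \<partial>P n) + (l2norm w)\<^sup>2"
    using F1(2) F2(2) by (simp add: P.prob_space)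
  also have "\<dots> = (\<integral>t. (\<integral>\<omega>. (\<psi> \<omega> t)\<^sup>2 \<partial>\<Omega>) \<partial>unif01) + (l2norm w)\<^sup>2"
    unfolding F1(1) F2(1) 1 2 using n by simp
  finally show "(\<integral>x. (l2norm (\<lambda>t. S n x t / sqrt (real n) + w t))\<^sup>2 \<partial>P n) =
      (\<integral>t. (\<integral>\<omega>. (\<psi> \<omega> t)\<^sup>2 \<partial>\<Omega>) \<partial>unif01) + (l2norm w)\<^sup>2" .
  show "integrable (P n) (\<lambda>x. (l2norm (\<lambda>t. S n x t / sqrt (real n) + w t))\<^sup>2)"
    by (subst Bochner_Integration.integrable_cong[OF refl eq])
       (use F1(2) F2(2) in \<open>auto intro!: Bochner_Integration.integrable_add\<close>)
qed

text \<open>Jensen's inequality in \<open>t\<close> moves the outer square inside the integral; then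
  the fourth moment bound applies pointwise in \<open>t\<close>.\<close>

lemma l2norm_S_power4_le:
  assumes n: "n > 0"
  shows "(\<integral>x. (l2norm (\<lambda>t. S n x t / sqrt (real n))) ^ 4 \<partial>P n) \<le> 3"
proof -
  interpret P: prob_space "P n" by (rule prob_space_P)
  note F4 = S_power_mult_fubini[OF bdd_borel_const[of 1], of n 4]
  have le: "(l2norm (\<lambda>t. S n x t / sqrt (real n))) ^ 4 \<le> (\<integral>t. S n x t ^ 4 * 1 \<partial>unif01) / (real n)\<^sup>2"
    if "x \<in> space (P n)" for x
  proof -
    have "(l2norm (\<lambda>t. S n x t / sqrt (real n))) ^ 4 = ((l2norm (\<lambda>t. S n x t / sqrt (real n)))\<^sup>2)\<^sup>2"
      by simp
    also have "\<dots> = (\<integral>t. S n x t ^ 2 / real n \<partial>unif01)\<^sup>2"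
      by (simp only: l2norm_sq) (simp add: power_divide)
    also have "\<dots> \<le> (\<integral>t. (S n x t ^ 2 / real n)\<^sup>2 \<partial>unif01)"
      using bdd_borel_S[OF that] by (intro power2_integral_le) auto
    finally show ?thesis by (simp add: power_divide)
  qed
  have 4: "(\<integral>x. S n x t ^ 4 \<partial>P n) \<le> 3 * (real n)\<^sup>2" for t
    by (rule integral_iid_sum_power4_le) (auto intro: prob_space_axioms \<psi>_bound \<psi>_centred)
  have "(\<integral>x. (l2norm (\<lambda>t. S n x t / sqrt (real n))) ^ 4 \<partial>P n) \<le>
      (\<integral>x. (\<integral>t. S n x t ^ 4 * 1 \<partial>unif01) / (real n)\<^sup>2 \<partial>P n)"
    using F4(2) le by (intro integral_mono_AE') auto
  also have "\<dots> = (\<integral>t. (\<integral>x. S n x t ^ 4 \<partial>P n) * 1 \<partial>unif01) / (real n)\<^sup>2"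
    using F4(1) by simp
  also have "\<dots> \<le> (3 * (real n)\<^sup>2) / (real n)\<^sup>2"
    using F4(3) 4 by (intro divide_right_mono U.integral_le_const) auto
  finally show ?thesis using n by simp
qed

end

section \<open>The empirical process and the quantile coupling\<close>

definition emp_proc :: "real measure \<Rightarrow> nat \<Rightarrow> (nat \<Rightarrow> real) \<Rightarrow> real \<Rightarrow> real" where
  "emp_proc M n x t = sqrt (real n) * (emp_df n x t - cdf M t)"

text \<open>For \<open>w = \<surd>n (F\<^sub>M - F\<^sub>0)\<close> the following is the square root of the Cramer--von Mises statistic
  under the law \<open>M\<close>; keeping \<open>M\<close> and the shift \<open>w\<close> apart allows replacing the law
  without changing the shift.\<close>
definition shifted_stat :: "real measure \<Rightarrow> nat \<Rightarrow> (real \<Rightarrow> real) \<Rightarrow> (nat \<Rightarrow> real) \<Rightarrow> real" where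
  "shifted_stat M n w x = l2norm (\<lambda>t. emp_proc M n x t + w t)"

lemma emp_df_eq_sum: "emp_df n x t = (\<Sum>i<n. if x i \<le> t then 1 else 0) / real n"
  by (simp add: emp_df_def sum.If_cases Int_def)

text \<open>Brings the process into the form \<open>S n x t / sqrt n\<close> of
  \<open>centred_kernel\<close>; for \<open>n = 0\<close> both sides are zero.\<close>

lemma emp_proc_eq_sum:
  "emp_proc M n x t = (\<Sum>i<n. (if x i \<le> t then 1 else 0) - cdf M t) / sqrt (real n)"
proof (cases "n = 0")
  case False
  then have "real n = sqrt (real n) * sqrt (real n)" by simp
  then show ?thesis using False
    by (simp add: emp_proc_def emp_df_eq_sum sum_subtractf field_simps del: real_sqrt_mult_self)
qed (simp add: emp_proc_def)

lemma bdd_borel_emp_df: "bdd_borel (emp_df n x)"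
proof -
  have "bdd_borel (\<lambda>t. if y \<le> t then 1 else 0)" for y :: real
    by (rule bdd_borelI[of _ 1]) auto
  then show ?thesis unfolding emp_df_eq_sum[abs_def] by (intro bdd_borel_divide bdd_borel_sum) auto
qed

lemma bdd_borel_emp_proc: "real_distribution M \<Longrightarrow> bdd_borel (emp_proc M n x)"
  unfolding emp_proc_def[abs_def]
  by (intro bdd_borel_mult bdd_borel_const bdd_borel_diff bdd_borel_emp_df bdd_borel_cdf)

lemma sets_sample: "real_distribution M \<Longrightarrow> sets (sample M n) = sets (PiM {..<n} (\<lambda>_. borel))"
  unfolding sample_def by (intro sets_PiM_cong) (auto simp: real_distribution.events_eq_borel)

lemma prob_space_sample: "real_distribution M \<Longrightarrow> prob_space (sample M n)"
  unfolding sample_def by (intro prob_space_PiM) (simp add: real_distribution_def)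

text \<open>The process is jointly measurable in the sample and in \<open>t\<close>, so integrating
  out \<open>t\<close> leaves a measurable function of the sample.\<close>

lemma measurable_shifted_stat:
  assumes "real_distribution M" "bdd_borel w"
  shows "shifted_stat M n w \<in> borel_measurable (PiM {..<n} (\<lambda>_. borel))"
proof -
  note [measurable] = bdd_borel_measurable[OF assms(2)] bdd_borel_measurable[OF bdd_borel_cdf[OF assms(1)]]
  have "(\<lambda>z. if fst z i \<le> snd z then 1 else 0 :: real) \<in>
      borel_measurable (PiM {..<n} (\<lambda>_. borel :: real measure) \<Otimes>\<^sub>M borel)" if "i < n" for i
  proof -
    have [measurable]: "(\<lambda>z. fst z i) \<in>
      borel_measurable (PiM {..<n} (\<lambda>_. borel :: real measure) \<Otimes>\<^sub>M (borel :: real measure))"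
      using that by (intro measurable_compose[OF measurable_fst] measurable_component_singleton) auto
    show ?thesis by measurable
  qed
  then have [measurable]: "(\<lambda>z. \<Sum>i<n. (if fst z i \<le> snd z then 1 else 0) - cdf M (snd z)) \<in>
      borel_measurable (PiM {..<n} (\<lambda>_. borel :: real measure) \<Otimes>\<^sub>M borel)"
    by (intro borel_measurable_sum borel_measurable_diff) auto
  have "(\<lambda>(x, t). (emp_proc M n x t + w t)\<^sup>2) \<in>
      borel_measurable (PiM {..<n} (\<lambda>_. borel) \<Otimes>\<^sub>M unif01)"
    unfolding emp_proc_eq_sum split_beta by measurable
  from U.borel_measurable_lebesgue_integral[OF this]
  show ?thesis unfolding shifted_stat_def[abs_def] l2norm_def by simp
qed

lemma centred_kernel_cdf:
  assumes "real_distribution M"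
  shows "centred_kernel M (\<lambda>y t. (if y \<le> t then 1 else 0) - cdf M t)"
proof -
  interpret real_distribution M by fact
  note [measurable] = bdd_borel_measurable[OF bdd_borel_cdf[OF assms(1)]]
  have e: "(if \<omega> \<le> t then 1 else 0) = (indicator {..t} \<omega> :: real)" for t \<omega> :: real
    by (auto simp: indicator_def)
  show ?thesis
  proof (unfold_locales, goal_cases)
    case 1 then show ?case by measurable
  next
    case (2 y t) then show ?case using cdf_nonneg[of t] cdf_bounded_prob[of t] by auto
  next
    case (3 t)
    have "integrable M (indicator {..t} :: real \<Rightarrow> real)" by (simp add: emeasure_eq_measure)
    then show ?case unfolding e
      by (simp add: prob_space[simplified] cdf_def)
  qed
qed

text \<open>At each \<open>t\<close> the kernel is a centred Bernoulli variable with variance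
  \<open>F (1 - F)\<close>. The fourth moment bound does not depend on \<open>n\<close> or on the
  law.\<close>

lemma shifted_stat_moments:
  assumes M: "real_distribution M" and w: "bdd_borel w" and n: "n > 0"
  shows "(\<integral>x. (shifted_stat M n w x)\<^sup>2 \<partial>sample M n) =
      (\<integral>t. cdf M t * (1 - cdf M t) \<partial>unif01) + (l2norm w)\<^sup>2"
    and "integrable (sample M n) (\<lambda>x. (shifted_stat M n w x)\<^sup>2)"
    and "(\<integral>x. (shifted_stat M n (\<lambda>_. 0) x) ^ 4 \<partial>sample M n) \<le> 3"
proof -
  interpret real_distribution M by fact
  interpret centred_kernel M "\<lambda>y t. (if y \<le> t then 1 else 0) - cdf M t"
    by (rule centred_kernel_cdf) fact
  have "(\<integral>\<omega>. ((if \<omega> \<le> t then 1 else 0) - cdf M t)\<^sup>2 \<partial>M) = cdf M t * (1 - cdf M t)" for t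
  proof -
    have e: "((if \<omega> \<le> t then 1 else 0) - cdf M t)\<^sup>2 = indicator {..t} \<omega> * (1 - 2 * cdf M t) + (cdf M t)\<^sup>2" for \<omega>
      by (auto simp: indicator_def power2_eq_square algebra_simps)
    have "integrable M (indicator {..t} :: real \<Rightarrow> real)" by (simp add: emeasure_eq_measure)
    then show ?thesis unfolding e
      by (simp add: prob_space[simplified] cdf_def[symmetric]) (simp add: cdf_def power2_eq_square algebra_simps)
  qed
  with l2norm_S_add_sq[OF w n] l2norm_S_power4_le[OF n]
  show "(\<integral>x. (shifted_stat M n w x)\<^sup>2 \<partial>sample M n) =
      (\<integral>t. cdf M t * (1 - cdf M t) \<partial>unif01) + (l2norm w)\<^sup>2"
    "integrable (sample M n) (\<lambda>x. (shifted_stat M n w x)\<^sup>2)"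
    "(\<integral>x. (shifted_stat M n (\<lambda>_. 0) x) ^ 4 \<partial>sample M n) \<le> 3"
    by (simp_all add: shifted_stat_def emp_proc_eq_sum sample_def)
qed

section \<open>Quantile coupling of two samples\<close>

lemma integral_lborel_unit_le:
  assumes "0 \<le> u" "u \<le> 1"
  shows "(\<integral>\<omega>. (if \<omega> \<le> u then 1 else 0) \<partial>restrict_space lborel {0<..<1}) = (u :: real)"
proof -
  have "(\<integral>\<omega>. (if \<omega> \<le> u then 1 else 0 :: real) \<partial>restrict_space lborel {0<..<1}) =
      (\<integral>\<omega>. indicator {0<..<1} \<omega> *\<^sub>R (if \<omega> \<le> u then 1 else 0) \<partial>lborel)"
    by (rule integral_restrict_space) auto
  also have "\<dots> = (\<integral>\<omega>. indicator {0<..<u} \<omega> \<partial>lborel)"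
    using AE_lborel_singleton[of u] AE_lborel_singleton[of "1 :: real"] assms
    by (intro integral_cong_AE) (auto simp: indicator_def elim!: eventually_elim2)
  also have "\<dots> = u" using assms by simp
  finally show ?thesis .
qed

text \<open>Both indicators use the same uniform variable, so they differ exactly on an interval of
  length \<open>|d|\<close>, where \<open>d\<close> is the difference of the two distribution
  functions at \<open>t\<close>. The variance of their difference is therefore
  \<open>|d| - d^2\<close>.\<close>

lemma centred_kernel_coupling:
  assumes M: "real_distribution M" and N: "real_distribution N"
  defines "\<psi> \<equiv> \<lambda>\<omega> t. ((if \<omega> \<le> cdf M t then 1 else 0) - cdf M t) - ((if \<omega> \<le> cdf N t then 1 else 0) - cdf N t)"
  shows "centred_kernel (restrict_space lborel {0<..<1}) \<psi>"
    and "(\<integral>\<omega>. (\<psi> \<omega> t)\<^sup>2 \<partial>restrict_space lborel {0<..<1}) \<le> \<bar>cdf M t - cdf N t\<bar>"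
proof -
  let ?\<Omega> = "restrict_space lborel {0<..<1} :: real measure"
  interpret \<Omega>: prob_space ?\<Omega>
    by (auto simp add: emeasure_restrict_space space_restrict_space intro!: prob_spaceI)
  note [measurable] = bdd_borel_measurable[OF bdd_borel_cdf[OF M]] bdd_borel_measurable[OF bdd_borel_cdf[OF N]]
  have b: "0 \<le> cdf M t" "cdf M t \<le> 1" "0 \<le> cdf N t" "cdf N t \<le> 1" for t
    using M N by (auto simp: real_distribution.cdf_bounded_prob
      finite_borel_measure.cdf_nonneg[OF real_distribution.finite_borel_measure_M])
  have id [measurable]: "(\<lambda>\<omega>. \<omega>) \<in> ?\<Omega> \<rightarrow>\<^sub>M borel" by (intro measurable_restrict_space1) auto
  have int: "integrable ?\<Omega> (\<lambda>\<omega>. if \<omega> \<le> u then 1 else 0 :: real)" for u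
    by (rule \<Omega>.integrable_bounded[of _ 1]) auto
  have pr: "measure ?\<Omega> {0<..<1} = 1" using \<Omega>.prob_space by (simp add: space_restrict_space)
  note I = integral_lborel_unit_le
  show "centred_kernel ?\<Omega> \<psi>"
  proof (unfold_locales, goal_cases)
    case 1
    have [measurable]: "fst \<in> ?\<Omega> \<Otimes>\<^sub>M (borel :: real measure) \<rightarrow>\<^sub>M borel"
      using measurable_compose[OF measurable_fst id] by simp
    show ?case unfolding \<psi>_def split_beta by measurable
  next
    case (2 y t) then show ?case using b[of t] by (auto simp: \<psi>_def)
  next
    case (3 t)
    show ?case unfolding \<psi>_def using b[of t] int by (simp add: I pr space_restrict_space)
  qed
  let ?d = "cdf M t - cdf N t"
  let ?D = "\<lambda>\<omega>. (if \<omega> \<le> cdf M t then 1 else 0) - (if \<omega> \<le> cdf N t then 1 else 0) :: real"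
  \<comment> \<open>Since \<open>?D\<close> takes only the values 0 and \<open>sgn ?d\<close>, its
    square is \<open>sgn ?d * ?D\<close>, which makes the whole expression affine in
    \<open>?D\<close>.\<close>
  have e: "(\<psi> \<omega> t)\<^sup>2 = (sgn ?d - 2 * ?d) * ?D \<omega> + ?d\<^sup>2" for \<omega>
    by (cases "?d > 0"; cases "?d = 0") (auto simp: \<psi>_def power2_eq_square algebra_simps sgn_if)
  have "(\<integral>\<omega>. (\<psi> \<omega> t)\<^sup>2 \<partial>?\<Omega>) = (sgn ?d - 2 * ?d) * ?d + ?d\<^sup>2"
    unfolding e using b[of t] int by (simp add: I pr space_restrict_space)
  also have "\<dots> = \<bar>?d\<bar> - ?d\<^sup>2" by (simp add: algebra_simps power2_eq_square abs_sgn)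
  finally show "(\<integral>\<omega>. (\<psi> \<omega> t)\<^sup>2 \<partial>?\<Omega>) \<le> \<bar>?d\<bar>" by simp
qed

text \<open>Inverse transform sampling in each coordinate, with the generalised inverse of the
  distribution function.\<close>

lemma
  assumes M: "real_distribution M"
  shows sample_eq_distr_quantile: "distr (PiM {..<n} (\<lambda>_. restrict_space lborel {0<..<1})) (sample M n)
      (compose {..<n} (\<lambda>\<omega>. Inf {x. \<omega> \<le> cdf M x})) = sample M n" (is ?distr)
    and measurable_quantile: "compose {..<n} (\<lambda>\<omega>. Inf {x. \<omega> \<le> cdf M x}) \<in>
      PiM {..<n} (\<lambda>_. restrict_space lborel {0<..<1}) \<rightarrow>\<^sub>M sample M n" (is ?meas)
proof -
  interpret cdf_distribution M using M by (simp add: cdf_distribution_def)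
  let ?\<Omega> = "restrict_space lborel {0<..<1} :: real measure"
  interpret \<Omega>: prob_space ?\<Omega>
    by (auto simp add: emeasure_restrict_space space_restrict_space intro!: prob_spaceI)
  have m [measurable]: "I \<in> ?\<Omega> \<rightarrow>\<^sub>M M"
    using measurable_CI by (simp cong: measurable_cong_sets add: sets_restrict_space)
  have "distr ?\<Omega> M I = M"
    using distr_I_eq_M by (simp cong: distr_cong)
  with distr_PiM_finite_prob_space'[of "{..<n}" "\<lambda>_. ?\<Omega>" "\<lambda>_. M" I] m show ?distr
    unfolding sample_def using \<Omega>.prob_space_axioms prob_space_axioms by simp
  show ?meas unfolding sample_def compose_def by measurable
qed

definition stat_prob :: "real measure \<Rightarrow> nat \<Rightarrow> (real \<Rightarrow> real) \<Rightarrow> real set \<Rightarrow> real" where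
  "stat_prob M n w A = measure (sample M n) {x \<in> space (sample M n). shifted_stat M n w x \<in> A}"

lemma stat_event_measurable:
  assumes "real_distribution M" "bdd_borel w" "A \<in> sets borel"
  shows "{x \<in> space (sample M n). shifted_stat M n w x \<in> A} \<in> sets (sample M n)"
proof -
  have [measurable]: "shifted_stat M n w \<in> borel_measurable (sample M n)"
    using measurable_shifted_stat[OF assms(1,2)] sets_sample[OF assms(1)]
    by (simp cong: measurable_cong_sets)
  show ?thesis using assms(3) by measurable
qed

text \<open>Both samples are generated from the same uniform variables. By the reverse triangle
  inequality the statistics differ by less than \<delta> unless the two processes are at distance at
  least \<delta>, and Chebyshev's inequality bounds that event. The shift \<open>w\<close> is the
  same on both sides.\<close>

lemma stat_prob_coupling:
  assumes M: "real_distribution M" and N: "real_distribution N" and w: "bdd_borel w"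
    and n: "n > 0" and \<delta>: "\<delta> > 0" and A: "A \<in> sets borel" and B: "B \<in> sets borel"
    and AB: "\<And>a b. a \<in> A \<Longrightarrow> \<bar>a - b\<bar> < \<delta> \<Longrightarrow> b \<in> B"
  shows "stat_prob M n w A \<le> stat_prob N n w B + (\<integral>t. \<bar>cdf M t - cdf N t\<bar> \<partial>unif01) / \<delta>\<^sup>2"
proof -
  let ?\<Omega> = "restrict_space lborel {0<..<1} :: real measure"
  let ?P = "PiM {..<n} (\<lambda>_. ?\<Omega>)"
  define q where "q L = compose {..<n} (\<lambda>\<omega>. Inf {x. \<omega> \<le> cdf L x})" for L
  define \<psi> where "\<psi> = (\<lambda>\<omega> t. ((if \<omega> \<le> cdf M t then 1 else 0) - cdf M t) - ((if \<omega> \<le> cdf N t then 1 else 0) - cdf N t))"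
  interpret K: centred_kernel ?\<Omega> \<psi>
    unfolding \<psi>_def by (rule centred_kernel_coupling(1)[OF M N])
  interpret P: prob_space ?P by (rule K.prob_space_P)
  have meas: "q L \<in> ?P \<rightarrow>\<^sub>M sample L n" if "real_distribution L" for L
    unfolding q_def by (rule measurable_quantile[OF that])
  have pull: "stat_prob L n w C = measure ?P {\<omega> \<in> space ?P. shifted_stat L n w (q L \<omega>) \<in> C}"
    and pull_sets: "{\<omega> \<in> space ?P. shifted_stat L n w (q L \<omega>) \<in> C} \<in> sets ?P"
    if "real_distribution L" "C \<in> sets borel" for L C
  proof -
    have e: "q L -` {x \<in> space (sample L n). shifted_stat L n w x \<in> C} \<inter> space ?P =
        {\<omega> \<in> space ?P. shifted_stat L n w (q L \<omega>) \<in> C}"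
      using measurable_space[OF meas[OF that(1)]] by auto
    have "stat_prob L n w C = measure (distr ?P (sample L n) (q L)) {x \<in> space (sample L n). shifted_stat L n w x \<in> C}"
      unfolding stat_prob_def q_def sample_eq_distr_quantile[OF that(1)] ..
    also have "\<dots> = measure ?P {\<omega> \<in> space ?P. shifted_stat L n w (q L \<omega>) \<in> C}"
      by (subst measure_distr[OF meas[OF that(1)] stat_event_measurable[OF that(1) w that(2)]]) (rule arg_cong[OF e])
    finally show "stat_prob L n w C = measure ?P {\<omega> \<in> space ?P. shifted_stat L n w (q L \<omega>) \<in> C}" .
    show "{\<omega> \<in> space ?P. shifted_stat L n w (q L \<omega>) \<in> C} \<in> sets ?P"
      using measurable_sets[OF meas[OF that(1)] stat_event_measurable[OF that(1) w that(2)]] unfolding e .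
  qed
  \<comment> \<open>The squared distance of the two coupled processes; \<open>+ 0\<close> is the
    zero shift of \<open>l2norm_S_add_sq\<close>.\<close>
  let ?Z = "\<lambda>\<omega>. (l2norm (\<lambda>t. K.S n \<omega> t / sqrt (real n) + 0))\<^sup>2"
  have quant: "emp_proc L n (q L \<omega>) t = (\<Sum>i<n. (if \<omega> i \<le> cdf L t then 1 else 0) - cdf L t) / sqrt (real n)"
    if "real_distribution L" "\<omega> \<in> space ?P" for L \<omega> t
  proof -
    interpret L: cdf_distribution L using that by (simp add: cdf_distribution_def)
    \<comment> \<open>The Galois connection between quantile function and distribution function: the
      transformed sample enters the process only through the comparisons of
      \<open>\<omega> i\<close> with \<open>cdf L t\<close>.\<close>
    have "q L \<omega> i \<le> t \<longleftrightarrow> \<omega> i \<le> cdf L t" if "i < n" for i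
      using L.pseudoinverse[of "\<omega> i" t] \<open>\<omega> \<in> space ?P\<close> that
      by (auto simp: q_def compose_def space_PiM space_restrict_space PiE_iff)
    then show ?thesis unfolding emp_proc_eq_sum by (intro arg_cong2[where f = "(/)"] sum.cong) auto
  qed
  have close: "\<bar>shifted_stat M n w (q M \<omega>) - shifted_stat N n w (q N \<omega>)\<bar> < \<delta>"
    if \<omega>: "\<omega> \<in> space ?P" and Z: "\<not> \<delta>\<^sup>2 \<le> ?Z \<omega>" for \<omega>
  proof -
    have "\<bar>shifted_stat M n w (q M \<omega>) - shifted_stat N n w (q N \<omega>)\<bar> \<le>
        l2norm (\<lambda>t. (emp_proc M n (q M \<omega>) t + w t) - (emp_proc N n (q N \<omega>) t + w t))"
      unfolding shifted_stat_def
      using w bdd_borel_emp_proc[OF M] bdd_borel_emp_proc[OF N] by (intro l2norm_diff_le) auto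
    also have "\<dots> = l2norm (\<lambda>t. K.S n \<omega> t / sqrt (real n) + 0)"
      by (simp add: quant[OF M \<omega>] quant[OF N \<omega>] \<psi>_def sum_subtractf diff_divide_distrib)
    also have "\<dots> < \<delta>"
      by (rule power2_less_imp_less) (use Z \<delta> in linarith)+
    finally show ?thesis .
  qed
  have int: "integrable ?P ?Z" by (rule K.l2norm_S_add_sq(2)[OF bdd_borel_const n])
  then have [measurable]: "?Z \<in> borel_measurable ?P" by (rule borel_measurable_integrable)
  have Zset: "{\<omega> \<in> space ?P. \<delta>\<^sup>2 \<le> ?Z \<omega>} \<in> sets ?P" by measurable
  have "stat_prob M n w A \<le> measure ?P ({\<omega> \<in> space ?P. shifted_stat N n w (q N \<omega>) \<in> B} \<union> {\<omega> \<in> space ?P. \<delta>\<^sup>2 \<le> ?Z \<omega>})"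
    unfolding pull[OF M A]
    using pull_sets[OF M A] pull_sets[OF N B] Zset close AB
    by (intro P.finite_measure_mono) blast+
  also have "\<dots> \<le> stat_prob N n w B + measure ?P {\<omega> \<in> space ?P. \<delta>\<^sup>2 \<le> ?Z \<omega>}"
    unfolding pull[OF N B] using pull_sets[OF N B] Zset by (intro measure_Un_le)
  also have "measure ?P {\<omega> \<in> space ?P. \<delta>\<^sup>2 \<le> ?Z \<omega>} \<le> (\<integral>\<omega>. ?Z \<omega> \<partial>?P) / \<delta>\<^sup>2"
    using \<delta> by (intro integral_Markov_inequality_measure[OF int sets.empty_sets]) auto
  also have "(\<integral>\<omega>. ?Z \<omega> \<partial>?P) = (\<integral>t. (\<integral>\<omega>. (\<psi> \<omega> t)\<^sup>2 \<partial>?\<Omega>) \<partial>unif01)"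
    using K.l2norm_S_add_sq(1)[OF bdd_borel_const n, of 0] by (simp add: l2norm_def)
  also have "\<dots> \<le> (\<integral>t. \<bar>cdf M t - cdf N t\<bar> \<partial>unif01)"
  proof (rule integral_mono_AE')
    show "integrable unif01 (\<lambda>t. \<bar>cdf M t - cdf N t\<bar>)"
      using bdd_borel_cdf[OF M] bdd_borel_cdf[OF N] by (intro bdd_borel_integrable) auto
    show "AE t in unif01. (\<integral>\<omega>. (\<psi> \<omega> t)\<^sup>2 \<partial>?\<Omega>) \<le> \<bar>cdf M t - cdf N t\<bar>"
      unfolding \<psi>_def by (intro AE_I2 centred_kernel_coupling(2) M N)
    show "AE t in unif01. 0 \<le> \<bar>cdf M t - cdf N t\<bar>" by simp
  qed
  finally show ?thesis using \<delta> by (simp add: divide_right_mono)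
qed

section \<open>Anti-concentration under the null hypothesis\<close>

lemma (in prob_space) power2_expectation_abs_le:
  fixes h :: "'a \<Rightarrow> real"
  assumes [measurable]: "h \<in> borel_measurable M" and "\<And>x. x \<in> space M \<Longrightarrow> \<bar>h x\<bar> \<le> B"
  shows "(\<integral>x. \<bar>h x\<bar> \<partial>M)\<^sup>2 \<le> (\<integral>x. (h x)\<^sup>2 \<partial>M)"
proof -
  have "integrable M (\<lambda>x. \<bar>h x\<bar>)" "integrable M (\<lambda>x. \<bar>h x\<bar>\<^sup>2)"
    using integrable_bounded[of "\<lambda>x. \<bar>h x\<bar>" B] integrable_bounded[of "\<lambda>x. (h x)\<^sup>2" "B\<^sup>2"]
      abs_power_le[OF assms(2), of _ 2] assms(2) by auto
  then have "variance (\<lambda>x. \<bar>h x\<bar>) = (\<integral>x. (h x)\<^sup>2 \<partial>M) - (\<integral>x. \<bar>h x\<bar> \<partial>M)\<^sup>2"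
    using variance_eq[of "\<lambda>x. \<bar>h x\<bar>"] by simp
  then show ?thesis using variance_positive[of "\<lambda>x. \<bar>h x\<bar>"] by simp
qed

text \<open>By uniqueness of the product measure it suffices to compare rectangles, where the
  integral of the product density factorises.\<close>

lemma PiM_density_prod:
  assumes "prob_space \<Omega>" and [measurable]: "f \<in> borel_measurable \<Omega>" and f: "\<And>\<omega>. 0 \<le> f \<omega>"
    and "prob_space (density \<Omega> (\<lambda>\<omega>. ennreal (f \<omega>)))" and "finite I"
  shows "PiM I (\<lambda>_. density \<Omega> (\<lambda>\<omega>. ennreal (f \<omega>))) =
    density (PiM I (\<lambda>_. \<Omega>)) (\<lambda>x. ennreal (\<Prod>i\<in>I. f (x i)))"
proof -
  interpret \<Omega>: prob_space \<Omega> by fact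
  interpret D: prob_space "density \<Omega> (\<lambda>\<omega>. ennreal (f \<omega>))" by fact
  interpret PO: product_prob_space "\<lambda>_. \<Omega>" by unfold_locales
  interpret PD: product_prob_space "\<lambda>_. density \<Omega> (\<lambda>\<omega>. ennreal (f \<omega>))" by unfold_locales
  show ?thesis
  proof (rule PD.PiM_eqI[symmetric])
    show "finite I" by fact
    show "sets (density (PiM I (\<lambda>_. \<Omega>)) (\<lambda>x. ennreal (\<Prod>i\<in>I. f (x i)))) =
        sets (PiM I (\<lambda>_. density \<Omega> (\<lambda>\<omega>. ennreal (f \<omega>))))"
      by (simp, intro sets_PiM_cong) auto
    fix A assume "\<And>i. i \<in> I \<Longrightarrow> A i \<in> sets (density \<Omega> (\<lambda>\<omega>. ennreal (f \<omega>)))"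
    then have A: "\<And>i. i \<in> I \<Longrightarrow> A i \<in> sets \<Omega>" by simp
    have "emeasure (density (PiM I (\<lambda>_. \<Omega>)) (\<lambda>x. ennreal (\<Prod>i\<in>I. f (x i)))) (Pi\<^sub>E I A) =
        (\<integral>\<^sup>+x. ennreal (\<Prod>i\<in>I. f (x i)) * indicator (Pi\<^sub>E I A) x \<partial>PiM I (\<lambda>_. \<Omega>))"
      using A \<open>finite I\<close> by (subst emeasure_density) (auto intro!: sets_PiM_I_finite)
    also have "\<dots> = (\<integral>\<^sup>+x. (\<Prod>i\<in>I. ennreal (f (x i)) * indicator (A i) (x i)) \<partial>PiM I (\<lambda>_. \<Omega>))"
    proof (intro nn_integral_cong)
      fix x assume "x \<in> space (PiM I (\<lambda>_. \<Omega>))"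
      then have "indicator (Pi\<^sub>E I A) x = (\<Prod>i\<in>I. indicator (A i) (x i) :: ennreal)"
        using \<open>finite I\<close> by (auto simp: indicator_def space_PiM PiE_iff prod_zero_iff)
      then show "ennreal (\<Prod>i\<in>I. f (x i)) * indicator (Pi\<^sub>E I A) x =
          (\<Prod>i\<in>I. ennreal (f (x i)) * indicator (A i) (x i))"
        using f by (simp add: prod_ennreal[symmetric] prod.distrib)
    qed
    also have "\<dots> = (\<Prod>i\<in>I. \<integral>\<^sup>+\<omega>. ennreal (f \<omega>) * indicator (A i) \<omega> \<partial>\<Omega>)"
      using A \<open>finite I\<close> by (intro PO.product_nn_integral_prod) auto
    also have "\<dots> = (\<Prod>i\<in>I. emeasure (density \<Omega> (\<lambda>\<omega>. ennreal (f \<omega>))) (A i))"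
      using A by (intro prod.cong refl) (simp add: emeasure_density)
    finally show "emeasure (density (PiM I (\<lambda>_. \<Omega>)) (\<lambda>x. ennreal (\<Prod>i\<in>I. f (x i)))) (Pi\<^sub>E I A) =
      (\<Prod>i\<in>I. emeasure (density \<Omega> (\<lambda>\<omega>. ennreal (f \<omega>))) (A i))" .
  qed
qed

lemma measure_density_eq_integral:
  fixes f :: "'a \<Rightarrow> real"
  assumes "f \<in> borel_measurable M" "\<And>x. 0 \<le> f x" "A \<in> sets M"
  shows "measure (density M (\<lambda>x. ennreal (f x))) A = (\<integral>x. f x * indicator A x \<partial>M)"
proof -
  have "measure (density M (\<lambda>x. ennreal (f x))) A = (\<integral>x. indicator A x \<partial>density M (\<lambda>x. ennreal (f x)))"
    using assms(3) by simp
  also have "\<dots> = (\<integral>x. f x * indicator A x \<partial>M)"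
    using assms by (subst integral_density) auto
  finally show ?thesis .
qed

text \<open>With \<open>g\<close> the likelihood ratio of the two product laws, the difference of
  probabilities is at most the \<open>L^1\<close> norm of \<open>1 - g\<close>, hence at most its
  \<open>L^2\<close> norm. The square of the latter is the chi-square divergence, computed from the
  second moment of \<open>f\<close> by independence.\<close>

lemma measure_PiM_density_ge:
  fixes n :: nat
  assumes "prob_space \<Omega>" and [measurable]: "f \<in> borel_measurable \<Omega>" and f: "\<And>\<omega>. 0 \<le> f \<omega>" "\<And>\<omega>. f \<omega> \<le> B"
    and f1: "(\<integral>\<omega>. f \<omega> \<partial>\<Omega>) = 1"
    and D: "prob_space (density \<Omega> (\<lambda>\<omega>. ennreal (f \<omega>)))"
    and [measurable]: "A \<in> sets (PiM {..<n} (\<lambda>_. \<Omega>))"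
  shows "measure (PiM {..<n} (\<lambda>_. \<Omega>)) A \<le>
    measure (PiM {..<n} (\<lambda>_. density \<Omega> (\<lambda>\<omega>. ennreal (f \<omega>)))) A + sqrt ((\<integral>\<omega>. (f \<omega>)\<^sup>2 \<partial>\<Omega>) ^ n - 1)"
proof -
  interpret \<Omega>: prob_space \<Omega> by fact
  interpret PO: product_prob_space "\<lambda>_::nat. \<Omega>" by unfold_locales
  let ?P = "PiM {..<n} (\<lambda>_. \<Omega>)"
  interpret Pn: prob_space ?P by (intro prob_space_PiM_const assms)
  define g where "g x = (\<Prod>i<n. f (x i))" for x
  have [measurable]: "g \<in> borel_measurable ?P" unfolding g_def by measurable
  have g: "0 \<le> g x" "g x \<le> B ^ n" for x
    using prod_mono[of "{..<n}" "\<lambda>i. f (x i)" "\<lambda>_. B"] f by (auto simp: g_def intro!: prod_nonneg)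
  have int: "integrable ?P g" "integrable ?P (\<lambda>x. (g x)\<^sup>2)"
    using Pn.integrable_bounded[of g "B ^ n"] Pn.integrable_bounded[of "\<lambda>x. (g x)\<^sup>2" "(B ^ n)\<^sup>2"]
      abs_power_le[of "g _" "B ^ n" 2] g by auto
  have intf: "integrable \<Omega> f" "integrable \<Omega> (\<lambda>x. (f x)\<^sup>2)"
    using \<Omega>.integrable_bounded[of f B] \<Omega>.integrable_bounded[of "\<lambda>x. (f x)\<^sup>2" "B\<^sup>2"]
      abs_power_le[of "f _" B 2] f by auto
  have g1: "(\<integral>x. g x \<partial>?P) = 1"
    unfolding g_def using PO.product_integral_prod[of "{..<n}" "\<lambda>_. f"] intf f1 by simp
  have g2: "(\<integral>x. (g x)\<^sup>2 \<partial>?P) = (\<integral>\<omega>. (f \<omega>)\<^sup>2 \<partial>\<Omega>) ^ n"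
    unfolding g_def prod_power_distrib
    using PO.product_integral_prod[of "{..<n}" "\<lambda>_ x. (f x)\<^sup>2"] intf by simp
  have "measure ?P A - measure (PiM {..<n} (\<lambda>_. density \<Omega> (\<lambda>\<omega>. ennreal (f \<omega>)))) A =
      (\<integral>x. indicator A x \<partial>?P) - (\<integral>x. g x * indicator A x \<partial>?P)"
    unfolding PiM_density_prod[OF assms(1,2) f(1) D finite_lessThan] g_def[symmetric]
    using g(1) by (subst measure_density_eq_integral) auto
  also have "\<dots> = (\<integral>x. (1 - g x) * indicator A x \<partial>?P)"
    using int integrable_real_mult_indicator[OF _ int(1), of A]
    by (subst Bochner_Integration.integral_diff[symmetric]) (auto simp: Pn.emeasure_eq_measure algebra_simps)
  also have "\<dots> \<le> (\<integral>x. \<bar>1 - g x\<bar> \<partial>?P)"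
    using int by (intro integral_mono_AE') (auto simp: indicator_def)
  also have "\<dots> \<le> sqrt (\<integral>x. (1 - g x)\<^sup>2 \<partial>?P)"
  proof (intro real_le_rsqrt Pn.power2_expectation_abs_le)
    show "\<bar>1 - g x\<bar> \<le> 1 + B ^ n" for x using g[of x] by linarith
  qed simp
  also have "(\<integral>x. (1 - g x)\<^sup>2 \<partial>?P) = (\<integral>\<omega>. (f \<omega>)\<^sup>2 \<partial>\<Omega>) ^ n - 1"
    using int by (simp add: power2_diff g1 g2 Pn.prob_space)
  finally show ?thesis by simp
qed

text \<open>Passing from the uniform law to \<open>tilt (s / \<surd>n)\<close> shifts the empirical process by
  \<open>s * tilt_dir\<close>, but changes probabilities of events about the sample by at most \<open>2 s\<close>.\<close>
definition tilt_sign :: "real \<Rightarrow> real" where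
  "tilt_sign x = (if x \<le> 1/2 then 1 else - 1)"

definition tilt :: "real \<Rightarrow> real measure" where
  "tilt \<epsilon> = density unif01 (\<lambda>x. ennreal (1 + \<epsilon> * tilt_sign x))"

text \<open>On the unit interval this is the tent function \<open>min t (1 - t)\<close>, the
  primitive of \<open>tilt_sign\<close>.\<close>

definition tilt_dir :: "real \<Rightarrow> real" where
  "tilt_dir t = 2 * cdf unif01 (min t (1/2)) - cdf unif01 t"

lemma tilt_sign_measurable [measurable]: "tilt_sign \<in> borel_measurable borel"
  unfolding tilt_sign_def[abs_def] by measurable

lemma tilt_nonneg: "\<bar>\<epsilon>\<bar> \<le> 1 \<Longrightarrow> 0 \<le> 1 + \<epsilon> * tilt_sign x"
  by (auto simp: tilt_sign_def)

lemma integral_tilt_sign: "(\<integral>x. tilt_sign x * indicator {..t} x \<partial>unif01) = tilt_dir t"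
proof -
  have e: "tilt_sign x * indicator {..t} x = 2 * indicator {..min t (1/2)} x - indicator {..t} x" for x
    by (auto simp: tilt_sign_def indicator_def min_def)
  show ?thesis unfolding e tilt_dir_def by (simp add: cdf_def U.emeasure_eq_measure)
qed

lemma integral_tilt_sign_0: "(\<integral>x. tilt_sign x \<partial>unif01) = 0"
proof -
  have "(\<integral>x. tilt_sign x \<partial>unif01) = (\<integral>x. tilt_sign x * indicator {..1} x \<partial>unif01)"
    using AE_unif01 by (intro integral_cong_AE) auto
  also have "\<dots> = 0" by (simp add: integral_tilt_sign tilt_dir_def cdf_unif01)
  finally show ?thesis .
qed

lemma integrable_tilt_sign [simp]: "integrable unif01 tilt_sign"
  by (rule bdd_borel_integrable, rule bdd_borelI[of _ 1]) (auto simp: tilt_sign_def)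

lemma real_distribution_tilt: "\<bar>\<epsilon>\<bar> \<le> 1 \<Longrightarrow> real_distribution (tilt \<epsilon>)"
proof -
  assume \<epsilon>: "\<bar>\<epsilon>\<bar> \<le> 1"
  have "prob_space (tilt \<epsilon>)"
  proof (rule prob_spaceI)
    have "emeasure (tilt \<epsilon>) (space (tilt \<epsilon>)) = (\<integral>\<^sup>+x. ennreal (1 + \<epsilon> * tilt_sign x) \<partial>unif01)"
      by (simp add: tilt_def emeasure_density)
    also have "\<dots> = ennreal (\<integral>x. 1 + \<epsilon> * tilt_sign x \<partial>unif01)"
      by (rule nn_integral_eq_integral) (auto simp: tilt_nonneg[OF \<epsilon>])
    also have "(\<integral>x. 1 + \<epsilon> * tilt_sign x \<partial>unif01) = 1"
      using U.prob_space by (simp add: integral_tilt_sign_0)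
    finally show "emeasure (tilt \<epsilon>) (space (tilt \<epsilon>)) = 1" by simp
  qed
  then show ?thesis
    by (simp add: real_distribution_def real_distribution_axioms_def tilt_def)
qed

lemma cdf_tilt: "\<bar>\<epsilon>\<bar> \<le> 1 \<Longrightarrow> cdf (tilt \<epsilon>) t = cdf unif01 t + \<epsilon> * tilt_dir t"
proof -
  assume \<epsilon>: "\<bar>\<epsilon>\<bar> \<le> 1"
  have "cdf (tilt \<epsilon>) t = (\<integral>x. (1 + \<epsilon> * tilt_sign x) * indicator {..t} x \<partial>unif01)"
    unfolding cdf_def tilt_def by (subst measure_density_eq_integral) (auto simp: tilt_nonneg[OF \<epsilon>])
  also have "\<dots> = (\<integral>x. indicator {..t} x + \<epsilon> * (tilt_sign x * indicator {..t} x) \<partial>unif01)"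
    by (simp add: algebra_simps)
  also have "\<dots> = cdf unif01 t + \<epsilon> * tilt_dir t"
    using integrable_real_mult_indicator[OF _ integrable_tilt_sign, of "{..t}"]
    by (simp add: U.emeasure_eq_measure integral_tilt_sign cdf_def)
  finally show ?thesis .
qed

lemma tilt_dir_abs_le: "\<bar>tilt_dir t\<bar> \<le> 1"
proof -
  have "cdf unif01 (min t (1/2)) \<le> cdf unif01 t" by (rule U.cdf_nondecreasing) simp
  moreover have "cdf unif01 (min t (1/2)) \<le> cdf unif01 (1/2)" by (rule U.cdf_nondecreasing) simp
  then have "cdf unif01 (min t (1/2)) \<le> 1/2" by (simp add: cdf_unif01)
  ultimately show ?thesis
    using U.cdf_nonneg[of "min t (1/2)"] U.cdf_bounded_prob[of t] by (simp add: tilt_dir_def abs_le_iff)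
qed

lemma bdd_borel_tilt_dir: "bdd_borel tilt_dir"
proof (rule bdd_borelI[OF _ tilt_dir_abs_le])
  have [measurable]: "cdf unif01 \<in> borel_measurable borel"
    by (rule bdd_borel_measurable[OF bdd_borel_cdf]) unfold_locales
  show "tilt_dir \<in> borel_measurable borel" unfolding tilt_dir_def[abs_def] by measurable
qed

lemma l2norm_tilt_dir_pos: "0 < l2norm tilt_dir"
proof -
  \<comment> \<open>The tent is at least 1/4 on the middle half of the unit interval, so its squared
    norm is at least 1/16 times 1/2.\<close>
  have "(1/32 :: real) = (\<integral>t. 1/16 * indicator {1/4..3/4} t \<partial>unif01)"
    by (simp add: unif01_def)
  also have "\<dots> \<le> (\<integral>t. (tilt_dir t)\<^sup>2 \<partial>unif01)"
  proof (rule integral_mono_AE')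
    show "integrable unif01 (\<lambda>t. (tilt_dir t)\<^sup>2)"
      using bdd_borel_tilt_dir by (intro bdd_borel_integrable) auto
    have "1/16 \<le> (tilt_dir t)\<^sup>2" if "1/4 \<le> t" "t \<le> 3/4" for t
    proof -
      have "1/4 \<le> tilt_dir t" using that by (auto simp: tilt_dir_def cdf_unif01 min_def)
      from power_mono[OF this, of 2] show ?thesis by (simp add: power2_eq_square)
    qed
    then show "AE t in unif01. 1/16 * indicator {1/4..3/4} t \<le> (tilt_dir t)\<^sup>2"
      by (auto simp: indicator_def)
  qed simp
  finally show ?thesis by (simp add: l2norm_def)
qed

text \<open>The tilted density has second moment \<open>1 + s^2 / n\<close>, whose
  \<open>n\<close>-th power stays below \<open>exp (s^2)\<close>. Tilting at the scale
  \<open>1 / sqrt n\<close> therefore has a cost that does not grow with \<open>n\<close>.\<close>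

lemma sample_tilt_ge:
  assumes n: "n > 0" and s: "0 \<le> s" "s \<le> 1" and A: "A \<in> sets (sample unif01 n)"
  shows "measure (sample unif01 n) A \<le> measure (sample (tilt (s / sqrt (real n))) n) A + 2 * s"
proof -
  define \<epsilon> where "\<epsilon> = s / sqrt (real n)"
  have \<epsilon>: "\<bar>\<epsilon>\<bar> \<le> 1" using n s by (simp add: \<epsilon>_def divide_le_eq order_trans[OF s(2)])
  have "measure (sample unif01 n) A \<le> measure (sample (tilt \<epsilon>) n) A +
      sqrt ((\<integral>x. (1 + \<epsilon> * tilt_sign x)\<^sup>2 \<partial>unif01) ^ n - 1)"
    unfolding sample_def tilt_def
  proof (rule measure_PiM_density_ge)
    show "1 + \<epsilon> * tilt_sign x \<le> 2" for x using \<epsilon> by (auto simp: tilt_sign_def abs_le_iff)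
    show "prob_space (density unif01 (\<lambda>x. ennreal (1 + \<epsilon> * tilt_sign x)))"
      using real_distribution_tilt[OF \<epsilon>] by (simp add: tilt_def real_distribution_def)
    show "(\<integral>x. 1 + \<epsilon> * tilt_sign x \<partial>unif01) = 1" using U.prob_space by (simp add: integral_tilt_sign_0)
  qed (use A tilt_nonneg[OF \<epsilon>] prob_space_unif01 in \<open>auto simp: sample_def\<close>)
  also have "(\<integral>x. (1 + \<epsilon> * tilt_sign x)\<^sup>2 \<partial>unif01) = (\<integral>x. (1 + \<epsilon>\<^sup>2) + 2 * \<epsilon> * tilt_sign x \<partial>unif01)"
    by (intro Bochner_Integration.integral_cong) (auto simp: tilt_sign_def power2_eq_square algebra_simps)
  also have "\<dots> = 1 + s\<^sup>2 / real n"
    using U.prob_space n by (simp add: integral_tilt_sign_0 \<epsilon>_def power_divide)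
  also have "sqrt ((1 + s\<^sup>2 / real n) ^ n - 1) \<le> 2 * s"
  proof (rule real_le_lsqrt)
    have s2: "s\<^sup>2 \<le> 1" "0 \<le> s\<^sup>2" using s by (auto simp: power_le_one)
    have "(1 + s\<^sup>2 / real n) ^ n \<le> exp (s\<^sup>2)"
      using n s2(2) of_nat_0_le_iff[of n] by (intro exp_ge_one_plus_x_over_n_power_n) linarith+
    also have "\<dots> \<le> 1 + s\<^sup>2 + (s\<^sup>2)\<^sup>2" using s2 by (intro exp_bound) auto
    also have "(s\<^sup>2)\<^sup>2 \<le> s\<^sup>2" using s2 power_decreasing[of 1 2 "s\<^sup>2"] by simp
    finally have "(1 + s\<^sup>2 / real n) ^ n - 1 \<le> 4 * s\<^sup>2" using s2(2) by linarith
    then show "(1 + s\<^sup>2 / real n) ^ n - 1 \<le> (2 * s)\<^sup>2" by (simp add: power_mult_distrib)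
    show "0 \<le> 2 * s" using s by simp
  qed
  finally show ?thesis unfolding \<epsilon>_def by simp
qed

section \<open>Averaging over tilts\<close>

text \<open>The second divided difference of a quadratic is its leading coefficient. Three values in
  one short interval would make it too small.\<close>

lemma quadratic_few_values_in_short_interval:
  fixes a b c \<sigma> lo hi :: real
  assumes \<sigma>: "\<sigma> > 0" and c: "hi - lo < c * \<sigma>\<^sup>2"
  shows "card {k \<in> {..<m}. a + 2 * b * (real k * \<sigma>) + c * (real k * \<sigma>)\<^sup>2 \<in> {lo..hi}} \<le> 2" (is "card ?T \<le> 2")
proof (rule ccontr)
  have no: False if "i \<in> ?T" "j \<in> ?T" "k \<in> ?T" "i < j" "j < k" for i j k
  proof -
    define q where "q l = a + 2 * b * (real l * \<sigma>) + c * (real l * \<sigma>)\<^sup>2" for l :: nat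
    define u v where "u = real j - real i" and "v = real k - real j"
    have uv: "1 \<le> u" "1 \<le> v" using that by (auto simp: u_def v_def)
    have q: "q i \<in> {lo..hi}" "q j \<in> {lo..hi}" "q k \<in> {lo..hi}" using that by (auto simp: q_def)
    \<comment> \<open>The second divided difference with cleared denominators; \<open>a\<close> and
      \<open>b\<close> cancel.\<close>
    have "c * \<sigma>\<^sup>2 * u * v * (u + v) = (q k - q j) * u - (q j - q i) * v"
      unfolding q_def u_def v_def by (simp add: power2_eq_square) algebra
    also have "\<dots> \<le> (hi - lo) * u + (hi - lo) * v"
    proof -
      have "(q k - q j) * u \<le> (hi - lo) * u" using q uv by (intro mult_right_mono) auto
      moreover have "(q i - q j) * v \<le> (hi - lo) * v" using q uv by (intro mult_right_mono) auto
      ultimately show ?thesis by (simp add: algebra_simps)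
    qed
    also have "\<dots> = (hi - lo) * (u + v)" by (simp add: algebra_simps)
    also have "\<dots> < c * \<sigma>\<^sup>2 * (u + v)" using c uv by (intro mult_strict_right_mono) auto
    also have "\<dots> \<le> (c * \<sigma>\<^sup>2 * (u + v)) * (u * v)"
    proof -
      have "1 \<le> u * v" using uv mult_mono[of 1 u 1 v] by simp
      \<comment> \<open>The interval contains \<open>q i\<close>, so its length is nonnegative, and
        \<open>c * \<sigma>^2\<close> exceeds that length.\<close>
      moreover have "0 \<le> c * \<sigma>\<^sup>2" using c q(1) by auto
      ultimately show ?thesis using uv mult_left_mono[of 1 "u * v" "c * \<sigma>\<^sup>2 * (u + v)"] by simp
    qed
    finally show False by (simp add: ac_simps)
  qed
  assume "\<not> card ?T \<le> 2"
  then have "Suc (Suc (Suc 0)) \<le> card ?T" by linarith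
  then obtain x y z where T: "x \<in> ?T" "y \<in> ?T" "z \<in> ?T" and "x \<noteq> y" "x \<noteq> z" "y \<noteq> z"
    unfolding card_le_Suc_iff by (metis insertCI)
  then show False
    using no[OF T] no[OF T(1,3,2)] no[OF T(2,1,3)] no[OF T(2,3,1)] no[OF T(3,1,2)] no[OF T(3,2,1)] by linarith
qed

text \<open>The event is compared with \<open>m\<close> events belonging to the shifts
  \<open>k \<sigma>\<close> along \<open>tilt_dir\<close>. Tilting costs
  \<open>2 m \<sigma>\<close>, and coupling back to the uniform law costs
  \<open>1 / (sqrt n * \<eta>^2)\<close>. Each sample lies in at most two of these events, which
  gives \<open>2 / m\<close> on average.\<close>

lemma anticoncentration_unif01_bound:
  assumes w: "bdd_borel w" and n: "n > 0" and m: "m > 0" and \<sigma>: "\<sigma> > 0" "real m * \<sigma> \<le> 1"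
    and \<eta>: "\<eta> > 0" and r: "0 \<le> r" and small: "8 * \<eta> * (r + 2 * \<eta>) < (l2norm tilt_dir)\<^sup>2 * \<sigma>\<^sup>2"
  shows "stat_prob unif01 n w {r - \<eta>..r + \<eta>} \<le> 2 * (real m * \<sigma>) + 2 / real m + 1 / (sqrt (real n) * \<eta>\<^sup>2)"
proof -
  interpret Sm: prob_space "sample unif01 n" by (rule prob_space_sample) unfold_locales
  have UD: "real_distribution unif01" by unfold_locales
  define ws where "ws k = (\<lambda>t. w t + (real k * \<sigma>) * tilt_dir t)" for k :: nat
  have ws: "bdd_borel (ws k)" for k
    unfolding ws_def by (intro bdd_borel_add bdd_borel_mult bdd_borel_const w bdd_borel_tilt_dir)
  \<comment> \<open>Wider by \<eta> on each side than the original interval, to allow for the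
    coupling.\<close>
  let ?J = "{r - 2 * \<eta><..<r + 2 * \<eta>}"
  have step: "stat_prob unif01 n w {r - \<eta>..r + \<eta>} \<le>
      stat_prob unif01 n (ws k) ?J + 1 / (sqrt (real n) * \<eta>\<^sup>2) + 2 * (real m * \<sigma>)" if k: "k < m" for k
  proof -
    define s \<epsilon> where "s = real k * \<sigma>" and "\<epsilon> = s / sqrt (real n)"
    have sm: "s \<le> real m * \<sigma>" using k \<sigma> by (simp add: s_def)
    have s: "0 \<le> s" "s \<le> 1" using order_trans[OF sm \<sigma>(2)] \<sigma>(1) by (auto simp: s_def)
    have \<epsilon>: "\<bar>\<epsilon>\<bar> \<le> 1" "0 \<le> \<epsilon>" "\<epsilon> \<le> 1 / sqrt (real n)"
      using n s by (auto simp: \<epsilon>_def divide_le_eq divide_right_mono order_trans[OF s(2)])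
    note TD = real_distribution_tilt[OF \<epsilon>(1)]
    \<comment> \<open>Recentring at the tilted distribution function lowers the process by exactly
      the amount that \<open>ws k\<close> adds, so the statistic is unchanged as a function of the
      sample.\<close>
    have "real k * \<sigma> = sqrt (real n) * \<epsilon>" using n by (simp add: \<epsilon>_def s_def)
    then have "emp_proc unif01 n x t + w t = emp_proc (tilt \<epsilon>) n x t + ws k t" for x t
      by (simp add: emp_proc_def ws_def cdf_tilt[OF \<epsilon>(1)] algebra_simps)
    then have eq: "shifted_stat unif01 n w x = shifted_stat (tilt \<epsilon>) n (ws k) x" for x
      by (simp add: shifted_stat_def)
    have "stat_prob unif01 n w {r - \<eta>..r + \<eta>} \<le> measure (sample (tilt \<epsilon>) n)
        {x \<in> space (sample unif01 n). shifted_stat unif01 n w x \<in> {r - \<eta>..r + \<eta>}} + 2 * s"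
      unfolding stat_prob_def \<epsilon>_def by (intro sample_tilt_ge n s stat_event_measurable UD w) auto
    also have "measure (sample (tilt \<epsilon>) n)
        {x \<in> space (sample unif01 n). shifted_stat unif01 n w x \<in> {r - \<eta>..r + \<eta>}} =
        stat_prob (tilt \<epsilon>) n (ws k) {r - \<eta>..r + \<eta>}"
      using sets_eq_imp_space_eq[OF sets_sample[OF TD]] sets_eq_imp_space_eq[OF sets_sample[OF UD]]
      unfolding stat_prob_def eq by simp
    also have "\<dots> \<le> stat_prob unif01 n (ws k) ?J + (\<integral>t. \<bar>cdf (tilt \<epsilon>) t - cdf unif01 t\<bar> \<partial>unif01) / \<eta>\<^sup>2"
      by (intro stat_prob_coupling TD UD ws n \<eta>) auto
    also have "(\<integral>t. \<bar>cdf (tilt \<epsilon>) t - cdf unif01 t\<bar> \<partial>unif01) \<le> 1 / sqrt (real n)"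
    proof (rule U.integral_le_const)
      show "integrable unif01 (\<lambda>t. \<bar>cdf (tilt \<epsilon>) t - cdf unif01 t\<bar>)"
        using bdd_borel_cdf[OF TD] bdd_borel_cdf[OF UD] by (intro bdd_borel_integrable) auto
      show "AE t in unif01. \<bar>cdf (tilt \<epsilon>) t - cdf unif01 t\<bar> \<le> 1 / sqrt (real n)"
      proof (rule AE_I2)
        fix t
        have "\<epsilon> * \<bar>tilt_dir t\<bar> \<le> 1 / sqrt (real n) * 1"
          using \<epsilon> tilt_dir_abs_le[of t] by (intro mult_mono) auto
        then show "\<bar>cdf (tilt \<epsilon>) t - cdf unif01 t\<bar> \<le> 1 / sqrt (real n)"
          using \<epsilon> by (simp add: cdf_tilt abs_mult)
      qed
    qed
    finally show ?thesis using sm \<eta> by (simp add: divide_right_mono)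
  qed
  have count: "(\<Sum>k<m. indicator {x \<in> space (sample unif01 n). shifted_stat unif01 n (ws k) x \<in> ?J} x) \<le> (2 :: real)" for x
  proof -
    define v where "v = (\<lambda>t. emp_proc unif01 n x t + w t)"
    have v: "bdd_borel v" unfolding v_def using w bdd_borel_emp_proc[OF UD] by auto
    define b where "b = (\<integral>t. v t * tilt_dir t \<partial>unif01)"
    have q: "(shifted_stat unif01 n (ws k) x)\<^sup>2 =
        (l2norm v)\<^sup>2 + 2 * b * (real k * \<sigma>) + (l2norm tilt_dir)\<^sup>2 * (real k * \<sigma>)\<^sup>2" for k
    proof -
      have "(shifted_stat unif01 n (ws k) x)\<^sup>2 = (l2norm (\<lambda>t. v t + (real k * \<sigma>) * tilt_dir t))\<^sup>2"
        by (simp add: shifted_stat_def ws_def v_def algebra_simps)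
      also have "\<dots> = (l2norm v)\<^sup>2 + 2 * (\<integral>t. v t * ((real k * \<sigma>) * tilt_dir t) \<partial>unif01) +
          (l2norm (\<lambda>t. (real k * \<sigma>) * tilt_dir t))\<^sup>2"
        using v bdd_borel_tilt_dir by (intro l2norm_add_sq) auto
      also have "(\<integral>t. v t * ((real k * \<sigma>) * tilt_dir t) \<partial>unif01) = (real k * \<sigma>) * b"
        unfolding b_def by (subst integral_mult_right_zero[symmetric]) (simp add: ac_simps)
      finally show ?thesis by (simp add: l2norm_scale power_mult_distrib algebra_simps)
    qed
    \<comment> \<open>For \<open>r < 2 * \<eta>\<close> the left end of \<open>?J\<close> is
      negative; as the statistic is nonnegative, its square is then only bounded below by 0.\<close>
    define lo where "lo = (max 0 (r - 2 * \<eta>))\<^sup>2"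
    have len: "(r + 2 * \<eta>)\<^sup>2 - lo \<le> 8 * \<eta> * (r + 2 * \<eta>)"
    proof (cases "r \<ge> 2 * \<eta>")
      case True
      then have "(r + 2 * \<eta>)\<^sup>2 - lo = 8 * \<eta> * r" by (simp add: lo_def max_def power2_eq_square algebra_simps)
      also have "\<dots> \<le> 8 * \<eta> * (r + 2 * \<eta>)" using \<eta> by (intro mult_left_mono) auto
      finally show ?thesis .
    next
      case False
      then have "(r + 2 * \<eta>)\<^sup>2 - lo = (r + 2 * \<eta>) * (r + 2 * \<eta>)" by (simp add: lo_def max_def power2_eq_square)
      also have "\<dots> \<le> (8 * \<eta>) * (r + 2 * \<eta>)" using False r \<eta> by (intro mult_right_mono) auto
      finally show ?thesis .
    qed
    let ?T = "{k \<in> {..<m}. (l2norm v)\<^sup>2 + 2 * b * (real k * \<sigma>) + (l2norm tilt_dir)\<^sup>2 * (real k * \<sigma>)\<^sup>2 \<in> {lo..(r + 2 * \<eta>)\<^sup>2}}"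
    have J: "y\<^sup>2 \<in> {lo..(r + 2 * \<eta>)\<^sup>2}" if "y \<in> ?J" "0 \<le> y" for y
      using that r \<eta> by (auto simp: lo_def intro!: power_mono)
    have "(\<Sum>k<m. indicator {x \<in> space (sample unif01 n). shifted_stat unif01 n (ws k) x \<in> ?J} x) \<le>
        (\<Sum>k<m. if k \<in> ?T then 1 else 0 :: real)"
    proof (intro sum_mono)
      fix k assume "k \<in> {..<m}"
      then show "indicator {x \<in> space (sample unif01 n). shifted_stat unif01 n (ws k) x \<in> ?J} x \<le>
          (if k \<in> ?T then 1 else 0 :: real)"
        using J[of "shifted_stat unif01 n (ws k) x"] q[of k]
        by (auto simp: indicator_def shifted_stat_def)
    qed
    also have "\<dots> = real (card ?T)"
      by (simp add: sum.If_cases) (rule arg_cong[where f = card], auto)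
    also have "\<dots> \<le> 2"
      using quadratic_few_values_in_short_interval[of \<sigma> "(r + 2 * \<eta>)\<^sup>2" lo "(l2norm tilt_dir)\<^sup>2" m "(l2norm v)\<^sup>2" b]
        \<sigma>(1) len small by simp
    finally show ?thesis .
  qed
  have sets: "{x \<in> space (sample unif01 n). shifted_stat unif01 n (ws k) x \<in> ?J} \<in> sets (sample unif01 n)" for k
    by (intro stat_event_measurable UD ws) auto
  \<comment> \<open>The expectation of the pointwise count is the sum of the probabilities.\<close>
  have "(\<Sum>k<m. stat_prob unif01 n (ws k) ?J) =
      (\<integral>x. (\<Sum>k<m. indicator {x \<in> space (sample unif01 n). shifted_stat unif01 n (ws k) x \<in> ?J} x) \<partial>sample unif01 n)"
    unfolding stat_prob_def using sets by (subst Bochner_Integration.integral_sum) (auto simp: Sm.emeasure_eq_measure)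
  also have "\<dots> \<le> 2"
    using sets count
    by (intro Sm.integral_le_const Bochner_Integration.integrable_sum) (auto simp: Sm.emeasure_eq_measure)
  finally have sum2: "(\<Sum>k<m. stat_prob unif01 n (ws k) ?J) \<le> 2" .
  have "real m * stat_prob unif01 n w {r - \<eta>..r + \<eta>} \<le>
      (\<Sum>k<m. stat_prob unif01 n (ws k) ?J + 1 / (sqrt (real n) * \<eta>\<^sup>2) + 2 * (real m * \<sigma>))"
    using sum_mono[of "{..<m}" "\<lambda>_. stat_prob unif01 n w {r - \<eta>..r + \<eta>}", OF step] by simp
  also have "\<dots> = (\<Sum>k<m. stat_prob unif01 n (ws k) ?J) + real m * (1 / (sqrt (real n) * \<eta>\<^sup>2)) + real m * (2 * (real m * \<sigma>))"
    by (simp add: sum.distrib)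
  also have "\<dots> \<le> real m * (2 * (real m * \<sigma>) + 2 / real m + 1 / (sqrt (real n) * \<eta>\<^sup>2))"
    using sum2 m by (simp add: distrib_left)
  finally show ?thesis using m by simp
qed

text \<open>Uniformity in \<open>w\<close> and \<open>r\<close> matters because both the shift and
  the threshold vary with \<open>n\<close>. The three terms of the preceding bound are made at most
  \<open>\<epsilon> / 3\<close> each by choosing \<open>m\<close>, \<sigma>, \<eta> and
  \<open>N\<close> in this order.\<close>

lemma anticoncentration_unif01:
  assumes \<epsilon>: "\<epsilon> > 0" and R: "R \<ge> 0"
  shows "\<exists>\<eta>>0. \<exists>N. \<forall>n\<ge>N. \<forall>w. bdd_borel w \<longrightarrow> (\<forall>r\<in>{0..R}. stat_prob unif01 n w {r - \<eta>..r + \<eta>} \<le> \<epsilon>)"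
proof -
  obtain m :: nat where m: "6 / \<epsilon> < real m" using reals_Archimedean2 by blast
  then have m0: "m > 0" using \<epsilon> by (metis divide_pos_pos gr0I less_asym of_nat_0 zero_less_numeral)
  define \<sigma> where "\<sigma> = min (\<epsilon> / 6) 1 / real m"
  have \<sigma>: "\<sigma> > 0" "real m * \<sigma> \<le> 1" "real m * \<sigma> \<le> \<epsilon> / 6" using \<epsilon> m0 by (auto simp: \<sigma>_def)
  define c where "c = (l2norm tilt_dir)\<^sup>2 * \<sigma>\<^sup>2"
  have c: "c > 0" using l2norm_tilt_dir_pos \<sigma> by (simp add: c_def)
  \<comment> \<open>Chosen so that \<open>8 * \<eta> * (r + 2 * \<eta>) < c\<close> for every
    \<open>r \<le> R\<close>; the cap 1 bounds the inner \<open>2 * \<eta>\<close> by 2.\<close>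
  define \<eta> where "\<eta> = min 1 (c / (16 * (R + 2)))"
  have \<eta>: "\<eta> > 0" "\<eta> \<le> 1" using c R by (auto simp: \<eta>_def)
  have "\<eta> * (16 * (R + 2)) \<le> c / (16 * (R + 2)) * (16 * (R + 2))"
    using R by (intro mult_right_mono) (auto simp: \<eta>_def)
  then have "\<eta> * (16 * (R + 2)) \<le> c" using R by simp
  then have \<eta>c: "16 * \<eta> * (R + 2) \<le> c" by (simp add: algebra_simps)
  obtain N :: nat where N: "(3 / (\<epsilon> * \<eta>\<^sup>2))\<^sup>2 < real N" using reals_Archimedean2 by blast
  show ?thesis
  proof (intro exI[of _ \<eta>] exI[of _ "max 1 N"] conjI allI impI ballI \<eta>)
    fix n w r assume n: "max 1 N \<le> n" and w: "bdd_borel w" and r: "r \<in> {0..R}"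
    have "8 * \<eta> * (r + 2 * \<eta>) \<le> 8 * \<eta> * (R + 2)" using r \<eta> by (intro mult_left_mono) auto
    also have "\<dots> < c" using \<eta>c c by simp
    finally have "stat_prob unif01 n w {r - \<eta>..r + \<eta>} \<le> 2 * (real m * \<sigma>) + 2 / real m + 1 / (sqrt (real n) * \<eta>\<^sup>2)"
      unfolding c_def using n r by (intro anticoncentration_unif01_bound w m0 \<sigma> \<eta>) auto
    also have "2 / real m \<le> \<epsilon> / 3" using m m0 \<epsilon> by (simp add: field_simps)
    also have "1 / (sqrt (real n) * \<eta>\<^sup>2) \<le> \<epsilon> / 3"
    proof -
      have "(3 / (\<epsilon> * \<eta>\<^sup>2))\<^sup>2 \<le> real n" using n N by simp
      then have "3 / (\<epsilon> * \<eta>\<^sup>2) \<le> sqrt (real n)" by (rule real_le_rsqrt)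
      then show ?thesis using \<epsilon> \<eta> n by (simp add: field_simps)
    qed
    finally show "stat_prob unif01 n w {r - \<eta>..r + \<eta>} \<le> \<epsilon>" using \<sigma>(3) by simp
  qed
qed

section \<open>The Cramer--von Mises statistic\<close>

text \<open>The squared \<open>l2norm\<close> of this function is
  \<open>n T^2(F - F_0)\<close>.\<close>

definition cvm_shift :: "real measure \<Rightarrow> nat \<Rightarrow> real \<Rightarrow> real" where
  "cvm_shift M n t = sqrt (real n) * (cdf M t - cdf unif01 t)"

lemma bdd_borel_cvm_shift: "real_distribution M \<Longrightarrow> bdd_borel (cvm_shift M n)"
  unfolding cvm_shift_def[abs_def]
  by (intro bdd_borel_mult bdd_borel_const bdd_borel_diff bdd_borel_cdf U.real_distribution_axioms)

lemma cvm_shift_unif01: "cvm_shift unif01 n = (\<lambda>_. 0)"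
  by (simp add: cvm_shift_def fun_eq_iff)

lemma emp_df_bounds: "0 \<le> emp_df n x t" "emp_df n x t \<le> 1"
proof -
  have "card {i \<in> {..<n}. x i \<le> t} \<le> card {..<n}" by (intro card_mono) auto
  then show "0 \<le> emp_df n x t" "emp_df n x t \<le> 1"
    by (auto simp: emp_df_def divide_le_eq_1)
qed

text \<open>The left side does not involve \<open>M\<close>: \<open>cdf M\<close> cancels between
  the process and the shift. Hence the identity is available for whichever law generates the
  sample.\<close>

lemma cvm_stat_eq_shifted_stat: "cvm_stat n x = (shifted_stat M n (cvm_shift M n) x)\<^sup>2"
proof -
  have [measurable]: "emp_df n x \<in> borel_measurable borel"
    by (rule bdd_borel_measurable[OF bdd_borel_emp_df])
  have [measurable]: "cdf unif01 \<in> borel_measurable borel"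
    by (rule bdd_borel_measurable[OF bdd_borel_cdf]) unfold_locales
  have "integral {0..1} (\<lambda>t. (emp_df n x t - t)\<^sup>2) = (\<integral>t. (emp_df n x t - t)\<^sup>2 \<partial>unif01)"
  proof (rule integral_unif01_eq)
    fix t :: real assume "0 \<le> t" "t \<le> 1"
    then show "\<bar>(emp_df n x t - t)\<^sup>2\<bar> \<le> 1\<^sup>2"
      using emp_df_bounds[where n=n and x=x and t=t] by (intro abs_power_le) (simp add: abs_le_iff)
  qed measurable
  also have "\<dots> = (\<integral>t. (emp_df n x t - cdf unif01 t)\<^sup>2 \<partial>unif01)"
    using AE_unif01 by (intro integral_cong_AE) (auto simp: cdf_unif01)
  finally have "cvm_stat n x = (\<integral>t. real n * (emp_df n x t - cdf unif01 t)\<^sup>2 \<partial>unif01)"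
    by (simp add: cvm_stat_def)
  also have "\<dots> = (shifted_stat M n (cvm_shift M n) x)\<^sup>2"
    unfolding shifted_stat_def l2norm_sq
  proof (intro Bochner_Integration.integral_cong refl)
    fix t
    have "emp_proc M n x t + cvm_shift M n t = sqrt (real n) * (emp_df n x t - cdf unif01 t)"
      by (simp add: emp_proc_def cvm_shift_def algebra_simps)
    then show "real n * (emp_df n x t - cdf unif01 t)\<^sup>2 = (emp_proc M n x t + cvm_shift M n t)\<^sup>2"
      by (simp add: power_mult_distrib)
  qed
  finally show ?thesis .
qed

lemma shifted_stat_nonneg [simp]: "0 \<le> shifted_stat M n w x"
  by (simp add: shifted_stat_def)

lemma reject_prob_eq_stat_prob:
  assumes "0 \<le> c"
  shows "reject_prob M n c = stat_prob M n (cvm_shift M n) {sqrt c<..}"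
proof -
  have "c < y\<^sup>2 \<longleftrightarrow> sqrt c < y" if "0 \<le> y" for y
    using assms that real_sqrt_less_iff[of c "y\<^sup>2"] by simp
  then show ?thesis
    by (simp add: reject_prob_def stat_prob_def cvm_stat_eq_shifted_stat[of _ _ M])
qed

text \<open>Rules out negative thresholds for tests whose size is below one.\<close>

lemma reject_prob_neg: "real_distribution M \<Longrightarrow> c < 0 \<Longrightarrow> reject_prob M n c = 1"
proof -
  assume "real_distribution M" "c < 0"
  then have "c < cvm_stat n x" for x
    unfolding cvm_stat_eq_shifted_stat[of _ _ M] by (smt (verit) zero_le_power2)
  then show ?thesis
    using prob_space.prob_space[OF prob_space_sample[OF \<open>real_distribution M\<close>]]
    by (simp add: reject_prob_def)
qed

section \<open>Dependence of the statistic on the shift\<close>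

text \<open>For a fixed sample the statistic is 1-Lipschitz in the shift, so in contrast to a change
  of law no probability is lost. With \<delta> zero and equal shifts this is monotonicity in the
  set.\<close>

lemma stat_prob_mono_shift:
  assumes M: "real_distribution M" and w: "bdd_borel w" "bdd_borel w'" and A: "A \<in> sets borel" "B \<in> sets borel"
    and \<delta>: "l2norm (\<lambda>t. w t - w' t) \<le> \<delta>" and AB: "\<And>a b. a \<in> A \<Longrightarrow> \<bar>a - b\<bar> \<le> \<delta> \<Longrightarrow> b \<in> B"
  shows "stat_prob M n w A \<le> stat_prob M n w' B"
proof -
  interpret S: prob_space "sample M n" by (rule prob_space_sample[OF M])
  have "\<bar>shifted_stat M n w x - shifted_stat M n w' x\<bar> \<le> \<delta>" for x
  proof -
    have "\<bar>shifted_stat M n w x - shifted_stat M n w' x\<bar> \<le>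
        l2norm (\<lambda>t. (emp_proc M n x t + w t) - (emp_proc M n x t + w' t))"
      unfolding shifted_stat_def using w bdd_borel_emp_proc[OF M] by (intro l2norm_diff_le) auto
    with \<delta> show ?thesis by simp
  qed
  with AB show ?thesis
    unfolding stat_prob_def
    by (intro S.finite_measure_mono stat_event_measurable M w A) blast
qed

lemma stat_prob_Compl:
  assumes "real_distribution M" "bdd_borel w" "A \<in> sets borel"
  shows "stat_prob M n w (- A) = 1 - stat_prob M n w A"
proof -
  interpret S: prob_space "sample M n" by (rule prob_space_sample) fact
  have "{x \<in> space (sample M n). shifted_stat M n w x \<in> - A} =
      space (sample M n) - {x \<in> space (sample M n). shifted_stat M n w x \<in> A}" by auto
  then show ?thesis
    unfolding stat_prob_def using S.prob_compl[OF stat_event_measurable[OF assms]] by simp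
qed

lemma cdf_unit_interval: "real_distribution M \<Longrightarrow> 0 \<le> cdf M t \<and> cdf M t \<le> 1"
  by (simp add: real_distribution.cdf_bounded_prob
      finite_borel_measure.cdf_nonneg[OF real_distribution.finite_borel_measure_M])

lemma bdd_borel_cdf_variance: "real_distribution M \<Longrightarrow> bdd_borel (\<lambda>t. cdf M t * (1 - cdf M t))"
  by (intro bdd_borel_mult bdd_borel_diff bdd_borel_const bdd_borel_cdf)

text \<open>Chebyshev's inequality: the mean square is the integral of \<open>F (1 - F)\<close>, so
  the bound is uniform in the law and in \<open>n\<close>.\<close>

lemma stat_prob_tail:
  assumes M: "real_distribution M" and n: "n > 0" and R: "R > 0"
  shows "stat_prob M n (\<lambda>_. 0) {R..} \<le> 1 / R\<^sup>2"
proof -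
  interpret S: prob_space "sample M n" by (rule prob_space_sample[OF M])
  note mom = shifted_stat_moments[OF M bdd_borel_const[of 0] n]
  have "y \<in> {R..} \<longleftrightarrow> R\<^sup>2 \<le> y\<^sup>2" if "0 \<le> y" for y
    using R that abs_le_square_iff[of R y] by simp
  then have "stat_prob M n (\<lambda>_. 0) {R..} =
      measure (sample M n) {x \<in> space (sample M n). R\<^sup>2 \<le> (shifted_stat M n (\<lambda>_. 0) x)\<^sup>2}"
    unfolding stat_prob_def by (metis (no_types, lifting) shifted_stat_nonneg)
  also have "\<dots> \<le> (\<integral>x. (shifted_stat M n (\<lambda>_. 0) x)\<^sup>2 \<partial>sample M n) / R\<^sup>2"
    using R by (intro integral_Markov_inequality_measure[OF mom(2) sets.empty_sets]) auto
  also have "(\<integral>x. (shifted_stat M n (\<lambda>_. 0) x)\<^sup>2 \<partial>sample M n) = (\<integral>t. cdf M t * (1 - cdf M t) \<partial>unif01)"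
    unfolding mom(1) by (simp add: l2norm_def)
  also have "\<dots> \<le> 1"
  proof (rule U.integral_le_const)
    show "integrable unif01 (\<lambda>t. cdf M t * (1 - cdf M t))"
      by (rule bdd_borel_integrable[OF bdd_borel_cdf_variance[OF M]])
    show "AE t in unif01. cdf M t * (1 - cdf M t) \<le> 1"
      using cdf_unit_interval[OF M] by (intro AE_I2 mult_le_one) auto
  qed
  finally show ?thesis using R by (simp add: divide_right_mono)
qed

text \<open>A small statistic under a large shift forces the centred process itself to be
  large.\<close>

lemma stat_prob_far_shift:
  assumes M: "real_distribution M" and w: "bdd_borel w" and n: "n > 0" and R: "l2norm w > R"
  shows "stat_prob M n w {..R} \<le> 1 / (l2norm w - R)\<^sup>2"
proof -
  interpret S: prob_space "sample M n" by (rule prob_space_sample[OF M])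
  have le: "l2norm w \<le> shifted_stat M n w x + shifted_stat M n (\<lambda>_. 0) x" for x
  proof -
    have "\<bar>l2norm (\<lambda>t. emp_proc M n x t + w t) - l2norm w\<bar> \<le> l2norm (\<lambda>t. (emp_proc M n x t + w t) - w t)"
      using w bdd_borel_emp_proc[OF M] by (intro l2norm_diff_le) auto
    then show ?thesis by (simp add: shifted_stat_def)
  qed
  have "stat_prob M n w {..R} \<le> stat_prob M n (\<lambda>_. 0) {l2norm w - R..}"
    unfolding stat_prob_def
  proof (intro S.finite_measure_mono stat_event_measurable M)
    show "{x \<in> space (sample M n). shifted_stat M n w x \<in> {..R}} \<subseteq>
        {x \<in> space (sample M n). shifted_stat M n (\<lambda>_. 0) x \<in> {l2norm w - R..}}"
    proof safe
      fix x assume "shifted_stat M n w x \<le> R"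
      with le[of x] show "l2norm w - R \<le> shifted_stat M n (\<lambda>_. 0) x" by linarith
    qed
  qed auto
  also have "\<dots> \<le> 1 / (l2norm w - R)\<^sup>2" using R by (intro stat_prob_tail M n) simp
  finally show ?thesis .
qed

section \<open>Inconsistency forces a vanishing shift\<close>

text \<open>A discrete layer-cake formula with mesh \<open>h\<close>, truncated at
  \<open>h m\<close>. It turns an inequality between rejection probabilities at the thresholds
  \<open>h k\<close> into one between truncated means.\<close>

lemma layer_cake_step_bounds:
  fixes S h :: real
  assumes "0 \<le> S" "0 < h"
  shows "min S (h * real m) \<le> (\<Sum>k<m. h * of_bool (h * real k < S))"
    and "(\<Sum>k<m. h * of_bool (h * real k < S)) \<le> h + S"
proof -
  show "min S (h * real m) \<le> (\<Sum>k<m. h * of_bool (h * real k < S))"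
  proof (induction m)
    case 0 then show ?case by simp
  next
    case (Suc m)
    have "min S (h * real (Suc m)) \<le> min S (h * real m) + h * of_bool (h * real m < S)"
      using assms by (auto simp: min_def algebra_simps)
    then show ?case using Suc by simp
  qed
  \<comment> \<open>The additional bound \<open>h m\<close> strengthens the induction: it is what
    gives \<open>h + S\<close> when the new term is still present.\<close>
  have "(\<Sum>k<m. h * of_bool (h * real k < S)) \<le> h + S \<and> (\<Sum>k<m. h * of_bool (h * real k < S)) \<le> h * real m"
  proof (induction m)
    case 0 then show ?case using assms by simp
  next
    case (Suc m)
    show ?case
    proof (cases "h * real m < S")
      case True
      then have "(\<Sum>k<Suc m. h * of_bool (h * real k < S)) = (\<Sum>k<m. h * of_bool (h * real k < S)) + h"
        unfolding sum.lessThan_Suc by simp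
      moreover have "h * real (Suc m) = h * real m + h" by (simp add: algebra_simps)
      ultimately show ?thesis using Suc True by linarith
    next
      case False
      then have "(\<Sum>k<Suc m. h * of_bool (h * real k < S)) = (\<Sum>k<m. h * of_bool (h * real k < S))"
        unfolding sum.lessThan_Suc by simp
      moreover have "h * real (Suc m) = h * real m + h" by (simp add: algebra_simps)
      ultimately show ?thesis using Suc assms(2) by linarith
    qed
  qed
  then show "(\<Sum>k<m. h * of_bool (h * real k < S)) \<le> h + S" by simp
qed

lemma shifted_stat_le:
  assumes M: "real_distribution M" and w: "bdd_borel w"
  shows "shifted_stat M n w x \<le> shifted_stat M n (\<lambda>_. 0) x + l2norm w"
    and "shifted_stat M n (\<lambda>_. 0) x \<le> sqrt (real n)"
proof -
  show "shifted_stat M n w x \<le> shifted_stat M n (\<lambda>_. 0) x + l2norm w"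
    unfolding shifted_stat_def using l2norm_triangle[OF bdd_borel_emp_proc[OF M] w] by simp
  have "(emp_proc M n x t)\<^sup>2 \<le> real n" for t
  proof -
    have "\<bar>emp_df n x t - cdf M t\<bar> \<le> 1"
      using emp_df_bounds[of n x t] cdf_unit_interval[OF M, of t] by (simp add: abs_le_iff)
    then have "(emp_df n x t - cdf M t)\<^sup>2 \<le> 1" by (simp add: abs_square_le_1)
    then show ?thesis by (simp add: emp_proc_def power_mult_distrib mult_left_le)
  qed
  then have "(\<integral>t. (emp_proc M n x t)\<^sup>2 \<partial>unif01) \<le> real n"
    using bdd_borel_emp_proc[OF M] by (intro U.integral_le_const bdd_borel_integrable) auto
  then show "shifted_stat M n (\<lambda>_. 0) x \<le> sqrt (real n)"
    by (simp add: shifted_stat_def l2norm_def)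
qed

text \<open>The test statistic is the square of \<open>shifted_stat\<close>, so this bounds its
  second moment and thereby the contribution of large values to its mean.\<close>

lemma stat_shift_power4_le:
  assumes M: "real_distribution M" and w: "bdd_borel w" and n: "n > 0"
  shows "integrable (sample M n) (\<lambda>x. shifted_stat M n w x ^ k)"
    and "(\<integral>x. shifted_stat M n w x ^ 4 \<partial>sample M n) \<le> 8 * (3 + l2norm w ^ 4)"
proof -
  interpret S: prob_space "sample M n" by (rule prob_space_sample[OF M])
  have meas: "shifted_stat M n v \<in> borel_measurable (sample M n)" if "bdd_borel v" for v
    using measurable_shifted_stat[OF M that] sets_sample[OF M] by (simp cong: measurable_cong_sets)
  have int: "integrable (sample M n) (\<lambda>x. shifted_stat M n v x ^ k)" if "bdd_borel v" for v k
  proof (rule S.integrable_bounded)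
    show "(\<lambda>x. shifted_stat M n v x ^ k) \<in> borel_measurable (sample M n)"
      using meas[OF that] by measurable
    show "\<bar>shifted_stat M n v x ^ k\<bar> \<le> (sqrt (real n) + l2norm v) ^ k" for x
      using shifted_stat_le[OF M that, of n x] by (intro abs_power_le) simp
  qed
  then show "integrable (sample M n) (\<lambda>x. shifted_stat M n w x ^ k)" using w .
  have conv: "(a + b) ^ 4 \<le> 8 * (a ^ 4 + b ^ 4)" for a b :: real
  proof -
    have "(a + b)\<^sup>2 \<le> 2 * (a\<^sup>2 + b\<^sup>2)"
      using sum_squares_bound[of a b] by (simp add: power2_sum)
    then have "((a + b)\<^sup>2)\<^sup>2 \<le> (2 * (a\<^sup>2 + b\<^sup>2))\<^sup>2"
      by (rule power_mono) simp
    also have "\<dots> \<le> 4 * (2 * ((a\<^sup>2)\<^sup>2 + (b\<^sup>2)\<^sup>2))"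
      using sum_squares_bound[of "a\<^sup>2" "b\<^sup>2"] by (simp add: power_mult_distrib power2_sum)
    finally show ?thesis by simp
  qed
  have "(\<integral>x. shifted_stat M n w x ^ 4 \<partial>sample M n) \<le>
      (\<integral>x. 8 * (shifted_stat M n (\<lambda>_. 0) x ^ 4 + l2norm w ^ 4) \<partial>sample M n)"
  proof (rule integral_mono)
    show "integrable (sample M n) (\<lambda>x. 8 * (shifted_stat M n (\<lambda>_. 0) x ^ 4 + l2norm w ^ 4))"
      using int[OF bdd_borel_const] by simp
    fix x
    have "shifted_stat M n w x ^ 4 \<le> (shifted_stat M n (\<lambda>_. 0) x + l2norm w) ^ 4"
      by (intro power_mono shifted_stat_le M w) simp
    from this conv show "shifted_stat M n w x ^ 4 \<le> 8 * (shifted_stat M n (\<lambda>_. 0) x ^ 4 + l2norm w ^ 4)"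
      by (rule order_trans)
  qed (rule int[OF w])
  also have "\<dots> = 8 * ((\<integral>x. shifted_stat M n (\<lambda>_. 0) x ^ 4 \<partial>sample M n) + l2norm w ^ 4)"
    using int[OF bdd_borel_const] by (simp add: S.prob_space)
  also have "\<dots> \<le> 8 * (3 + l2norm w ^ 4)" using shifted_stat_moments(3)[OF M w n] by simp
  finally show "(\<integral>x. shifted_stat M n w x ^ 4 \<partial>sample M n) \<le> 8 * (3 + l2norm w ^ 4)" .
qed

text \<open>The map \<open>u (1 - u)\<close> is 1-Lipschitz on the unit interval.\<close>

lemma cdf_variance_ge:
  assumes M: "real_distribution M"
  shows "(\<integral>t. cdf unif01 t * (1 - cdf unif01 t) \<partial>unif01) - (\<integral>t. \<bar>cdf M t - cdf unif01 t\<bar> \<partial>unif01)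
    \<le> (\<integral>t. cdf M t * (1 - cdf M t) \<partial>unif01)"
proof -
  have UD: "real_distribution unif01" by unfold_locales
  have bm: "bdd_borel (\<lambda>t. \<bar>cdf M t - cdf unif01 t\<bar>)"
    using bdd_borel_cdf[OF M] bdd_borel_cdf[OF UD] by auto
  note int = bdd_borel_integrable[OF bdd_borel_cdf_variance[OF M]]
    bdd_borel_integrable[OF bdd_borel_cdf_variance[OF UD]] bdd_borel_integrable[OF bm]
  have "(\<integral>t. cdf unif01 t * (1 - cdf unif01 t) - \<bar>cdf M t - cdf unif01 t\<bar> \<partial>unif01)
      \<le> (\<integral>t. cdf M t * (1 - cdf M t) \<partial>unif01)"
  proof (intro integral_mono Bochner_Integration.integrable_diff int)
    fix t
    let ?u = "cdf unif01 t" and ?v = "cdf M t"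
    have "?u * (1 - ?u) - ?v * (1 - ?v) = (?v - ?u) * (?u + ?v - 1)" by (simp add: algebra_simps)
    also have "\<dots> \<le> \<bar>?v - ?u\<bar> * \<bar>?u + ?v - 1\<bar>" by (metis abs_ge_self abs_mult)
    also have "\<dots> \<le> \<bar>?v - ?u\<bar>"
      using cdf_unit_interval[OF M, of t] cdf_unit_interval[OF UD, of t] by (intro mult_left_le) auto
    finally show "?u * (1 - ?u) - \<bar>?v - ?u\<bar> \<le> ?v * (1 - ?v)" by linarith
  qed
  then show ?thesis using int by simp
qed

text \<open>A bounded shift puts the law within order \<open>1 / sqrt n\<close> of the uniform one,
  so the coupling error for fixed \<delta> vanishes.\<close>

lemma integral_cdf_diff_le:
  assumes M: "real_distribution M" and n: "n > 0"
  shows "(\<integral>t. \<bar>cdf M t - cdf unif01 t\<bar> \<partial>unif01) \<le> l2norm (cvm_shift M n) / sqrt (real n)"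
proof -
  have UD: "real_distribution unif01" by unfold_locales
  have "(\<integral>t. \<bar>cdf M t - cdf unif01 t\<bar> \<partial>unif01) \<le> l2norm (\<lambda>t. cdf M t - cdf unif01 t)"
    by (intro integral_abs_le_l2norm bdd_borel_diff bdd_borel_cdf M UD)
  also have "\<dots> = l2norm (cvm_shift M n) / sqrt (real n)"
    using n by (simp add: cvm_shift_def[abs_def] l2norm_scale)
  finally show ?thesis .
qed

text \<open>The mean of the statistic exceeds its null value by the squared shift, up to the change
  of the variance term. Domination of all rejection probabilities limits this excess:
  \<open>h\<close> is the discretisation error, \<open>h m \<epsilon>\<close> the accumulated slack,
  and the last term the loss from truncating at \<open>h m\<close>.\<close>

lemma l2norm_cvm_shift_le:
  assumes M: "real_distribution M" and n: "n > 0" and h: "h > 0" and m: "m > 0"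
    and dom: "\<And>c. reject_prob M n c \<le> reject_prob unif01 n c + \<epsilon>"
  shows "(l2norm (cvm_shift M n))\<^sup>2 \<le> l2norm (cvm_shift M n) / sqrt (real n) + h + h * real m * \<epsilon>
    + 8 * (3 + l2norm (cvm_shift M n) ^ 4) / (h * real m)"
proof -
  have UD: "real_distribution unif01" by unfold_locales
  define L where "L = h * real m"
  have L: "L > 0" using h m by (simp add: L_def)
  have rej: "(\<integral>x. of_bool (c < (shifted_stat N n (cvm_shift N n) x)\<^sup>2) \<partial>sample N n) = reject_prob N n c"
    and rej_int: "integrable (sample N n) (\<lambda>x. of_bool (c < (shifted_stat N n (cvm_shift N n) x)\<^sup>2) :: real)"
    if N: "real_distribution N" for N c
  proof -
    interpret S: prob_space "sample N n" by (rule prob_space_sample[OF N])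
    have [measurable]: "(\<lambda>x. (shifted_stat N n (cvm_shift N n) x)\<^sup>2) \<in> borel_measurable (sample N n)"
      using stat_shift_power4_le(1)[OF N bdd_borel_cvm_shift[OF N] n, of n 2] by (rule borel_measurable_integrable)
    let ?A = "{x \<in> space (sample N n). c < (shifted_stat N n (cvm_shift N n) x)\<^sup>2}"
    have A: "?A \<in> sets (sample N n)" by measurable
    have "(\<integral>x. of_bool (c < (shifted_stat N n (cvm_shift N n) x)\<^sup>2) \<partial>sample N n) =
        (\<integral>x. (indicator ?A x :: real) \<partial>sample N n)"
      by (intro Bochner_Integration.integral_cong) (auto simp: indicator_def)
    then show "(\<integral>x. of_bool (c < (shifted_stat N n (cvm_shift N n) x)\<^sup>2) \<partial>sample N n) = reject_prob N n c"
      using A by (simp add: reject_prob_def cvm_stat_eq_shifted_stat[of _ _ N])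
    show "integrable (sample N n) (\<lambda>x. of_bool (c < (shifted_stat N n (cvm_shift N n) x)\<^sup>2) :: real)"
      by (rule S.integrable_bounded[of _ 1]) auto
  qed
  define SM where "SM x = (shifted_stat M n (cvm_shift M n) x)\<^sup>2" for x
  define SU where "SU x = (shifted_stat unif01 n (cvm_shift unif01 n) x)\<^sup>2" for x
  have SM: "integrable (sample M n) SM" "integrable (sample M n) (\<lambda>x. (SM x)\<^sup>2)"
    "(\<integral>x. (SM x)\<^sup>2 \<partial>sample M n) \<le> 8 * (3 + l2norm (cvm_shift M n) ^ 4)"
    using stat_shift_power4_le(1)[OF M bdd_borel_cvm_shift[OF M] n, of n 2]
      stat_shift_power4_le(1)[OF M bdd_borel_cvm_shift[OF M] n, of n 4]
      stat_shift_power4_le(2)[OF M bdd_borel_cvm_shift[OF M] n, of n] by (simp_all add: SM_def[abs_def])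
  have SU: "integrable (sample unif01 n) SU"
    using stat_shift_power4_le(1)[OF UD bdd_borel_cvm_shift[OF UD] n, of n 2] by (simp add: SU_def[abs_def])
  interpret SU: prob_space "sample unif01 n" by (rule prob_space_sample[OF UD])
  have "(\<integral>x. SM x \<partial>sample M n) \<le> (\<integral>x. (\<Sum>k<m. h * of_bool (h * real k < SM x)) + (SM x)\<^sup>2 / L \<partial>sample M n)"
  proof (intro integral_mono Bochner_Integration.integrable_add Bochner_Integration.integrable_sum)
    show "integrable (sample M n) (\<lambda>x. h * of_bool (h * real k < SM x))" for k
      using rej_int[OF M] by (simp add: SM_def)
    fix x
    have S0: "0 \<le> SM x" by (simp add: SM_def)
    \<comment> \<open>Above the level \<open>L\<close> the value is at most its square divided by
      \<open>L\<close>, which the second moment controls.\<close>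
    have "SM x \<le> min (SM x) L + (SM x)\<^sup>2 / L"
    proof (cases "SM x \<le> L")
      case False
      then have "SM x * L \<le> (SM x)\<^sup>2" using S0 by (simp add: power2_eq_square mult_left_mono)
      then show ?thesis using False L S0 by (simp add: min_def field_simps add_increasing)
    qed (use L in simp)
    also have "min (SM x) L \<le> (\<Sum>k<m. h * of_bool (h * real k < SM x))"
      unfolding L_def by (rule layer_cake_step_bounds(1)[OF S0 h])
    finally show "SM x \<le> (\<Sum>k<m. h * of_bool (h * real k < SM x)) + (SM x)\<^sup>2 / L" by simp
  qed (use SM in auto)
  also have "\<dots> = (\<Sum>k<m. h * reject_prob M n (h * real k)) + (\<integral>x. (SM x)\<^sup>2 \<partial>sample M n) / L"
    using rej_int[OF M] SM rej[OF M]
    by (simp add: SM_def[symmetric] del: sum_of_bool_mult_eq sum_mult_of_bool_eq sum_of_bool_eq)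
  also have "\<dots> \<le> (\<Sum>k<m. h * (reject_prob unif01 n (h * real k) + \<epsilon>)) + 8 * (3 + l2norm (cvm_shift M n) ^ 4) / L"
    using h L SM(3) dom by (intro add_mono sum_mono mult_left_mono divide_right_mono) auto
  also have "(\<Sum>k<m. h * (reject_prob unif01 n (h * real k) + \<epsilon>)) = (\<Sum>k<m. h * reject_prob unif01 n (h * real k)) + L * \<epsilon>"
    by (simp add: distrib_left sum.distrib L_def)
  also have "(\<Sum>k<m. h * reject_prob unif01 n (h * real k)) = (\<integral>x. (\<Sum>k<m. h * of_bool (h * real k < SU x)) \<partial>sample unif01 n)"
    using rej_int[OF UD] rej[OF UD]
    by (simp add: SU_def[symmetric] del: sum_of_bool_mult_eq sum_mult_of_bool_eq sum_of_bool_eq)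
  also have "\<dots> \<le> (\<integral>x. h + SU x \<partial>sample unif01 n)"
  proof (intro integral_mono Bochner_Integration.integrable_sum)
    show "integrable (sample unif01 n) (\<lambda>x. h * of_bool (h * real k < SU x))" for k
      using rej_int[OF UD] by (simp add: SU_def)
    show "(\<Sum>k<m. h * of_bool (h * real k < SU x)) \<le> h + SU x" for x
      by (rule layer_cake_step_bounds(2)[OF _ h]) (simp add: SU_def)
  qed (use SU in auto)
  also have "\<dots> = h + (\<integral>t. cdf unif01 t * (1 - cdf unif01 t) \<partial>unif01)"
    using SU shifted_stat_moments(1)[OF UD bdd_borel_cvm_shift[OF UD] n, of n]
    by (simp add: SU.prob_space SU_def[symmetric]) (simp add: cvm_shift_unif01 l2norm_def)
  finally have "(\<integral>t. cdf M t * (1 - cdf M t) \<partial>unif01) + (l2norm (cvm_shift M n))\<^sup>2 \<le>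
      h + (\<integral>t. cdf unif01 t * (1 - cdf unif01 t) \<partial>unif01) + L * \<epsilon> + 8 * (3 + l2norm (cvm_shift M n) ^ 4) / L"
    using shifted_stat_moments(1)[OF M bdd_borel_cvm_shift[OF M] n, of n] by (simp add: SM_def[symmetric])
  with cdf_variance_ge[OF M] integral_cdf_diff_le[OF M n] show ?thesis unfolding L_def by linarith
qed

lemma reject_prob_ge_far:
  assumes M: "real_distribution M" and n: "n > 0" and c: "0 \<le> c"
    and \<kappa>: "\<kappa> > 0" "l2norm (cvm_shift M n) \<ge> sqrt c + \<kappa>"
  shows "reject_prob M n c \<ge> 1 - 1 / \<kappa>\<^sup>2"
proof -
  let ?w = "cvm_shift M n"
  have w: "bdd_borel ?w" by (rule bdd_borel_cvm_shift[OF M])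
  have "reject_prob M n c = 1 - stat_prob M n ?w {..sqrt c}"
    unfolding reject_prob_eq_stat_prob[OF c] using stat_prob_Compl[OF M w, of "{..sqrt c}" n] by simp
  moreover have "stat_prob M n ?w {..sqrt c} \<le> 1 / (l2norm ?w - sqrt c)\<^sup>2"
    using \<kappa> by (intro stat_prob_far_shift M w n) auto
  moreover have "\<dots> \<le> 1 / \<kappa>\<^sup>2"
    using \<kappa> by (intro divide_left_mono power_mono) auto
  ultimately show ?thesis by linarith
qed

text \<open>The thresholds in the definition of inconsistency are arbitrary, hence may be chosen
  worst-case for each \<open>n\<close>.\<close>
lemma inconsistent_seq_dominated:
  assumes "inconsistent_seq F" and \<epsilon>: "\<epsilon> > 0"
  shows "eventually (\<lambda>n. \<forall>c. reject_prob (F n) n c \<le> reject_prob unif01 n c + \<epsilon>) sequentially"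
proof -
  define c where "c n = (SOME c. \<not> reject_prob (F n) n c \<le> reject_prob unif01 n c + \<epsilon>)" for n
  have "1 \<le> liminf (\<lambda>n. ereal (type1 n (c n) + type2 (F n) n (c n)))"
    using assms(1) by (auto simp: inconsistent_seq_def)
  moreover have "ereal (1 - \<epsilon>) < 1" using \<epsilon> by (simp add: one_ereal_def)
  ultimately have "eventually (\<lambda>n. ereal (1 - \<epsilon>) < ereal (type1 n (c n) + type2 (F n) n (c n))) sequentially"
    unfolding le_Liminf_iff by blast
  then show ?thesis
  proof eventually_elim
    case (elim n)
    show ?case
    proof (rule ccontr)
      assume "\<not> (\<forall>c. reject_prob (F n) n c \<le> reject_prob unif01 n c + \<epsilon>)"
      then have "\<not> reject_prob (F n) n (c n) \<le> reject_prob unif01 n (c n) + \<epsilon>"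
        unfolding c_def by (metis (mono_tags, lifting) someI_ex)
      with elim show False by (simp add: type1_def type2_def)
    qed
  qed
qed

text \<open>The bound of \<open>l2norm_cvm_shift_le\<close> contains the fourth power of the shift
  on its right side, so boundedness is shown first and convergence afterwards.\<close>

lemma inconsistent_seq_imp_shift_tendsto_0:
  assumes "inconsistent_seq F" and F: "\<And>n. real_distribution (F n)"
  shows "(\<lambda>n. l2norm (cvm_shift (F n) n)) \<longlonglongrightarrow> 0"
proof -
  have UD: "real_distribution unif01" by unfold_locales
  define d where "d n = l2norm (cvm_shift (F n) n)" for n
  \<comment> \<open>At threshold 4 the null law rejects with probability at most 1/4, whereas a
    shift of norm at least 4 gives at least 3/4. A slack of 1/4 cannot bridge this gap.\<close>
  have bounded: "eventually (\<lambda>n. d n < 4) sequentially"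
    using inconsistent_seq_dominated[OF assms(1), of "1/4", simplified] eventually_gt_at_top[of 0]
  proof eventually_elim
    case (elim n)
    show ?case
    proof (rule ccontr)
      assume "\<not> d n < 4"
      then have d: "2 \<le> d n - 2" by simp
      have "reject_prob unif01 n 4 = stat_prob unif01 n (\<lambda>_. 0) {2<..}"
        by (simp add: reject_prob_eq_stat_prob cvm_shift_unif01)
      also have "\<dots> \<le> stat_prob unif01 n (\<lambda>_. 0) {2..}"
        by (rule stat_prob_mono_shift[OF UD, where \<delta> = 0]) (auto simp: l2norm_def)
      also have "\<dots> \<le> 1/4" using stat_prob_tail[OF UD elim(2), of 2] by simp
      finally have u: "reject_prob unif01 n 4 \<le> 1/4" .
      have "1 - 1 / 2\<^sup>2 \<le> reject_prob (F n) n 4"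
        using d elim(2) by (intro reject_prob_ge_far F) (auto simp: d_def)
      moreover have "reject_prob (F n) n 4 \<le> reject_prob unif01 n 4 + 1/4" using elim(1) by simp
      ultimately show False using u by simp
    qed
  qed
  have "eventually (\<lambda>n. d n < e) sequentially" if e: "e > 0" for e
  proof -
    \<comment> \<open>Each of the four terms of the bound will be at most \<open>h\<close>, for a
      total of \<open>4 e^2 / 5\<close>.\<close>
    define h where "h = e\<^sup>2 / 5"
    have h: "h > 0" using e by (simp add: h_def)
    \<comment> \<open>2072 is \<open>8 * (3 + 4 ^ 4)\<close>, the moment bound for shifts of norm
      below 4.\<close>
    obtain m :: nat where m: "2072 / (h * h) < real m" using reals_Archimedean2 by blast
    have m0: "m > 0" using m h by (metis divide_pos_pos gr0I less_asym mult_pos_pos of_nat_0 zero_less_numeral)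
    define \<epsilon> where "\<epsilon> = 1 / real m"
    have \<epsilon>: "\<epsilon> > 0" using m0 by (simp add: \<epsilon>_def)
    have "(\<lambda>n. 4 / sqrt (real n)) \<longlonglongrightarrow> 0" by real_asymp
    then have "eventually (\<lambda>n. 4 / sqrt (real n) < h) sequentially"
      using h by (rule order_tendstoD(2))
    with bounded inconsistent_seq_dominated[OF assms(1) \<epsilon>] eventually_gt_at_top[of 0]
    show ?thesis
    proof eventually_elim
      case (elim n)
      have d0: "0 \<le> d n" by (simp add: d_def)
      have "(d n)\<^sup>2 \<le> d n / sqrt (real n) + h + h * real m * \<epsilon> + 8 * (3 + d n ^ 4) / (h * real m)"
        unfolding d_def using elim(2) by (intro l2norm_cvm_shift_le F elim(3) h m0) auto
      also have "d n / sqrt (real n) \<le> 4 / sqrt (real n)"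
        using elim(1) by (intro divide_right_mono) auto
      also have "4 / sqrt (real n) \<le> h" using elim(4) by simp
      also have "h * real m * \<epsilon> = h" using m0 by (simp add: \<epsilon>_def)
      also have "8 * (3 + d n ^ 4) / (h * real m) \<le> 2072 / (h * real m)"
        using power_mono[of "d n" 4 4] d0 elim(1) h by (intro divide_right_mono) auto
      also have "2072 / (h * real m) \<le> h" using m h m0 by (simp add: field_simps)
      finally have "(d n)\<^sup>2 \<le> 4 * h" by simp
      also have "\<dots> < e\<^sup>2" using e by (simp add: h_def)
      finally show "d n < e" using e by (intro power2_less_imp_less[of "d n" e]) auto
    qed
  qed
  then show ?thesis unfolding d_def by (intro order_tendstoI) (auto intro!: always_eventually less_le_trans[OF _ l2norm_nonneg])
qed

section \<open>Comparison of the tests under the two alternatives\<close>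

lemma reject_prob_le_inverse:
  assumes n: "n > 0" and c: "c > 0"
  shows "reject_prob unif01 n c \<le> 1 / c"
proof -
  have UD: "real_distribution unif01" by unfold_locales
  have "reject_prob unif01 n c = stat_prob unif01 n (\<lambda>_. 0) {sqrt c<..}"
    using c by (simp add: reject_prob_eq_stat_prob cvm_shift_unif01)
  also have "\<dots> \<le> stat_prob unif01 n (\<lambda>_. 0) {sqrt c..}"
    by (rule stat_prob_mono_shift[OF UD, where \<delta> = 0]) (auto simp: l2norm_def)
  also have "\<dots> \<le> 1 / c" using stat_prob_tail[OF UD n, of "sqrt c"] c by simp
  finally show ?thesis .
qed

lemma stat_prob_greaterThan_le_split:
  assumes M: "real_distribution M" and w: "bdd_borel w"
  shows "stat_prob M n w {r<..} \<le> stat_prob M n w {s<..} + stat_prob M n w {r..s}"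
proof -
  interpret S: prob_space "sample M n" by (rule prob_space_sample[OF M])
  let ?E = "\<lambda>A. {x \<in> space (sample M n). shifted_stat M n w x \<in> A}"
  have ev: "?E {s<..} \<in> sets (sample M n)" "?E {r..s} \<in> sets (sample M n)"
    by (intro stat_event_measurable M w; simp)+
  have "measure (sample M n) (?E {r<..}) \<le> measure (sample M n) (?E {s<..} \<union> ?E {r..s})"
    using ev by (intro S.finite_measure_mono) auto
  also have "\<dots> \<le> measure (sample M n) (?E {s<..}) + measure (sample M n) (?E {r..s})"
    using ev by (rule measure_Un_le)
  finally show ?thesis unfolding stat_prob_def .
qed

text \<open>Passing from \<open>N\<close> to \<open>M\<close> takes two moves: exchanging the shifts
  moves the threshold by \<open>\<eta> / 4\<close> at no cost in probability, and coupling the laws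
  moves it by another \<open>\<eta> / 4\<close> at a cost governed by the shift of \<open>L\<close>.
  What remains is the mass within \<open>\<eta> / 2\<close> of the threshold.\<close>

lemma reject_prob_diff_le:
  assumes M: "real_distribution M" and N: "real_distribution N" and L: "real_distribution L"
    and N_eq: "\<And>t. cdf N t = cdf M t + cdf L t - cdf unif01 t"
    and n: "n > 0" and c: "0 \<le> c" and \<eta>: "\<eta> > 0"
    and d: "l2norm (cvm_shift L n) \<le> \<eta> / 4"
    and ac: "stat_prob unif01 n (cvm_shift M n) {sqrt c - \<eta>..sqrt c + \<eta>} \<le> \<epsilon>"
  shows "\<bar>reject_prob M n c - reject_prob N n c\<bar> \<le>
    \<epsilon> + 4 * (l2norm (cvm_shift M n) / sqrt (real n)) / \<eta>\<^sup>2 + 16 * l2norm (cvm_shift L n) / \<eta>\<^sup>2"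
proof -
  have UD: "real_distribution unif01" by unfold_locales
  define r where "r = sqrt c"
  let ?w = "cvm_shift M n" and ?v = "cvm_shift N n"
  have w: "bdd_borel ?w" and v: "bdd_borel ?v" by (intro bdd_borel_cvm_shift M N)+
  have vw: "?v t - ?w t = cvm_shift L n t" for t
    by (simp add: cvm_shift_def N_eq algebra_simps)
  have wv: "l2norm (\<lambda>t. ?w t - ?v t) = l2norm (cvm_shift L n)"
    using l2norm_uminus[of "\<lambda>t. ?w t - ?v t"] by (simp add: vw)
  \<comment> \<open>The difference of the two laws is that of \<open>L\<close> and the uniform law;
    the available factor \<open>1 / sqrt n\<close> is discarded.\<close>
  have L1: "(\<integral>t. \<bar>cdf M t - cdf N t\<bar> \<partial>unif01) \<le> l2norm (cvm_shift L n)"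
  proof -
    have "(\<integral>t. \<bar>cdf M t - cdf N t\<bar> \<partial>unif01) = (\<integral>t. \<bar>cdf L t - cdf unif01 t\<bar> \<partial>unif01)"
      by (intro Bochner_Integration.integral_cong refl) (simp add: N_eq)
    also have "\<dots> \<le> l2norm (cvm_shift L n) / sqrt (real n)" by (rule integral_cdf_diff_le[OF L n])
    also have "\<dots> \<le> l2norm (cvm_shift L n)" using n mult_left_mono[of 1 "sqrt (real n)" "l2norm (cvm_shift L n)"] by (simp add: divide_le_eq)
    finally show ?thesis .
  qed
  have L1': "(\<integral>t. \<bar>cdf N t - cdf M t\<bar> \<partial>unif01) \<le> l2norm (cvm_shift L n)"
    using L1 by (simp add: abs_minus_commute)
  let ?e = "16 * l2norm (cvm_shift L n) / \<eta>\<^sup>2"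
  \<comment> \<open>Coupling \<open>M\<close> to the uniform law with tolerance
    \<open>\<eta> / 2\<close> makes the anti-concentration hypothesis on the interval of radius
    \<eta> applicable.\<close>
  have near: "stat_prob M n ?w {r - \<eta>/2..r + \<eta>/2} \<le> \<epsilon> + 4 * (l2norm ?w / sqrt (real n)) / \<eta>\<^sup>2"
  proof -
    have "stat_prob M n ?w {r - \<eta>/2..r + \<eta>/2} \<le> stat_prob unif01 n ?w {r - \<eta>..r + \<eta>} +
        (\<integral>t. \<bar>cdf M t - cdf unif01 t\<bar> \<partial>unif01) / (\<eta>/2)\<^sup>2"
    proof (rule stat_prob_coupling[OF M UD w n])
      fix a b assume "a \<in> {r - \<eta>/2..r + \<eta>/2}" and ab: "\<bar>a - b\<bar> < \<eta>/2"
      moreover from ab have "a - b < \<eta>/2" "b - a < \<eta>/2" by linarith+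
      ultimately show "b \<in> {r - \<eta>..r + \<eta>}" by simp
    qed (use \<eta> in auto)
    also have "\<dots> \<le> \<epsilon> + (l2norm ?w / sqrt (real n)) / (\<eta>/2)\<^sup>2"
      using ac integral_cdf_diff_le[OF M n] unfolding r_def by (intro add_mono divide_right_mono) auto
    finally show ?thesis by (simp add: power_divide mult.commute)
  qed
  have near_sub: "stat_prob M n ?w {r - \<eta>/2..r} \<le> stat_prob M n ?w {r - \<eta>/2..r + \<eta>/2}"
      "stat_prob M n ?w {r..r + \<eta>/2} \<le> stat_prob M n ?w {r - \<eta>/2..r + \<eta>/2}"
    using \<eta> by (intro stat_prob_mono_shift[OF M w w, where \<delta> = 0]; auto simp: l2norm_def)+
  have "stat_prob N n ?v {r<..} \<le> stat_prob N n ?w {r - \<eta>/4<..}"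
    using d by (intro stat_prob_mono_shift[OF N v w, where \<delta> = "\<eta>/4"]) ((simp add: vw; fail) | (unfold greaterThan_iff, linarith))+
  also have "\<dots> \<le> stat_prob M n ?w {r - \<eta>/2<..} + (\<integral>t. \<bar>cdf N t - cdf M t\<bar> \<partial>unif01) / (\<eta>/4)\<^sup>2"
    using \<eta> by (intro stat_prob_coupling N M w n) ((simp; fail) | (unfold greaterThan_iff, linarith))+
  also have "\<dots> \<le> (stat_prob M n ?w {r<..} + stat_prob M n ?w {r - \<eta>/2..r}) + l2norm (cvm_shift L n) / (\<eta>/4)\<^sup>2"
    by (intro add_mono divide_right_mono stat_prob_greaterThan_le_split M w L1') simp
  finally have 1: "stat_prob N n ?v {r<..} \<le> stat_prob M n ?w {r<..} + stat_prob M n ?w {r - \<eta>/2..r} + ?e"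
    by (simp add: power_divide ac_simps)
  have "stat_prob M n ?w {r<..} \<le> stat_prob M n ?w {r + \<eta>/2<..} + stat_prob M n ?w {r..r + \<eta>/2}"
    by (rule stat_prob_greaterThan_le_split[OF M w])
  also have "stat_prob M n ?w {r + \<eta>/2<..} \<le> stat_prob N n ?w {r + \<eta>/4<..} + (\<integral>t. \<bar>cdf M t - cdf N t\<bar> \<partial>unif01) / (\<eta>/4)\<^sup>2"
    using \<eta> by (intro stat_prob_coupling N M w n) ((simp; fail) | (unfold greaterThan_iff, linarith))+
  also have "\<dots> \<le> stat_prob N n ?v {r<..} + l2norm (cvm_shift L n) / (\<eta>/4)\<^sup>2"
  proof (intro add_mono divide_right_mono L1)
    show "stat_prob N n ?w {r + \<eta>/4<..} \<le> stat_prob N n ?v {r<..}"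
      using d by (intro stat_prob_mono_shift[OF N w v, where \<delta> = "\<eta>/4"]) ((simp add: wv; fail) | (unfold greaterThan_iff, linarith))+
  qed simp
  finally have 2: "stat_prob M n ?w {r<..} \<le> stat_prob N n ?v {r<..} + ?e + stat_prob M n ?w {r..r + \<eta>/2}"
    by (simp add: power_divide ac_simps)
  from 1 2 near near_sub show ?thesis
    unfolding reject_prob_eq_stat_prob[OF c] r_def[symmetric] by linarith
qed

lemma reject_prob_le_1: "real_distribution M \<Longrightarrow> reject_prob M n c \<le> 1"
  unfolding reject_prob_def by (intro prob_space.prob_le_1 prob_space_sample)

theorem theorem19:
  fixes a :: real and F F1 F2 :: "nat \<Rightarrow> real measure"
  assumes "0 < a" "a < 1"
    and "\<And>n. dist01 (F n)" and "\<And>n. dist01 (F1 n)" and "\<And>n. dist01 (F2 n)"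
    and "consistent_seq F" and "inconsistent_seq F1"
    and "\<And>n x. cdf (F2 n) x = cdf (F n) x + cdf (F1 n) x - cdf unif01 x"
  shows "\<forall>c :: nat \<Rightarrow> real. ((\<lambda>n. type1 n (c n) / a) \<longlonglongrightarrow> 1) \<longrightarrow>
           ((\<lambda>n. type2 (F n) n (c n) - type2 (F2 n) n (c n)) \<longlonglongrightarrow> 0)"
proof (intro allI impI)
  fix c :: "nat \<Rightarrow> real" assume c: "(\<lambda>n. type1 n (c n) / a) \<longlonglongrightarrow> 1"
  have UD: "real_distribution unif01" by unfold_locales
  have D: "real_distribution (F n)" "real_distribution (F1 n)" "real_distribution (F2 n)" for n
    using assms(3-5) by (auto intro: dist01_real_distribution)
  define d where "d n = l2norm (cvm_shift (F1 n) n)" for n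
  have d: "d \<longlonglongrightarrow> 0"
    unfolding d_def[abs_def] by (rule inconsistent_seq_imp_shift_tendsto_0[OF assms(7) D(2)])
  \<comment> \<open>The size eventually exceeds \<open>a / 2\<close> and is at most
    \<open>1 / c n\<close> for positive \<open>c n\<close>, which gives
    \<open>c n \<le> 2 / a\<close>.\<close>
  define R where "R = sqrt (2 / a)"
  have R: "R \<ge> 0" using assms(1) by (simp add: R_def)
  have c_range: "eventually (\<lambda>n. 0 \<le> c n \<and> sqrt (c n) \<le> R) sequentially"
  proof -
    have "eventually (\<lambda>n. 1/2 < type1 n (c n) / a) sequentially"
      by (rule order_tendstoD(1)[OF c]) simp
    \<comment> \<open>This says that the size is below 1, which excludes negative
      thresholds.\<close>
    moreover have "eventually (\<lambda>n. type1 n (c n) / a < 1 / a) sequentially"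
      by (rule order_tendstoD(2)[OF c]) (use assms(1,2) in simp)
    ultimately show ?thesis using eventually_gt_at_top[of 0]
    proof eventually_elim
      case (elim n)
      have t: "a / 2 < reject_prob unif01 n (c n)" "reject_prob unif01 n (c n) < 1"
        using elim assms(1) by (auto simp: type1_def field_simps)
      have c0: "0 \<le> c n" using reject_prob_neg[OF UD, of "c n" n] t(2) by fastforce
      moreover have "c n \<le> 2 / a"
      proof (cases "c n = 0")
        case False
        with c0 have "c n > 0" by simp
        then have "a / 2 < 1 / c n" using reject_prob_le_inverse[of n "c n"] t(1) elim by linarith
        then show ?thesis using \<open>c n > 0\<close> assms(1) by (simp add: field_simps)
      qed (use assms(1) in simp)
      ultimately show ?case by (simp add: R_def)
    qed
  qed
  have ev: "eventually (\<lambda>n. \<bar>reject_prob (F n) n (c n) - reject_prob (F2 n) n (c n)\<bar> < \<epsilon>) sequentially"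
    if \<epsilon>: "\<epsilon> > 0" for \<epsilon>
  proof -
    \<comment> \<open>A shift exceeding the critical value by \<kappa> gives rejection probability
      at least \<open>1 - \<epsilon> / 2\<close>.\<close>
    define \<kappa> where "\<kappa> = sqrt (2 / \<epsilon>)"
    have \<kappa>: "\<kappa> > 0" "1 / \<kappa>\<^sup>2 = \<epsilon> / 2" using \<epsilon> by (auto simp: \<kappa>_def)
    \<comment> \<open>The summand 1 absorbs \<open>d n\<close>, so that a shift of
      \<open>F n\<close> above \<open>K\<close> keeps the shift of \<open>F2 n\<close> above
      \<open>R + \<kappa>\<close>.\<close>
    define K where "K = R + 1 + \<kappa>"
    obtain \<eta> N where \<eta>: "\<eta> > 0" and ac: "\<And>n w r. N \<le> n \<Longrightarrow> bdd_borel w \<Longrightarrow> r \<in> {0..R} \<Longrightarrow>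
        stat_prob unif01 n w {r - \<eta>..r + \<eta>} \<le> \<epsilon> / 4"
      using anticoncentration_unif01[OF _ R, of "\<epsilon> / 4"] \<epsilon> by (metis divide_pos_pos zero_less_numeral)
    have "(\<lambda>n. 4 * (K / sqrt (real n)) / \<eta>\<^sup>2) \<longlonglongrightarrow> 0" using \<eta> by real_asymp
    then have "eventually (\<lambda>n. 4 * (K / sqrt (real n)) / \<eta>\<^sup>2 < \<epsilon> / 4) sequentially"
      using \<epsilon> by (intro order_tendstoD(2)) auto
    moreover have "(\<lambda>n. 16 * d n / \<eta>\<^sup>2) \<longlonglongrightarrow> 0" using tendsto_divide[OF tendsto_mult[OF tendsto_const d] tendsto_const, of "\<eta>\<^sup>2" 16] \<eta> by simp
    then have "eventually (\<lambda>n. 16 * d n / \<eta>\<^sup>2 < \<epsilon> / 4) sequentially"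
      using \<epsilon> by (intro order_tendstoD(2)) auto
    moreover have "eventually (\<lambda>n. d n < min 1 (\<eta> / 4)) sequentially"
      using \<eta> by (intro order_tendstoD(2)[OF d]) auto
    ultimately show ?thesis
      using c_range eventually_gt_at_top[of 0] eventually_ge_at_top[of N]
    proof eventually_elim
      case (elim n)
      have dF2: "l2norm (cvm_shift (F n) n) \<le> l2norm (cvm_shift (F2 n) n) + d n"
      proof -
        have "l2norm (cvm_shift (F n) n) - l2norm (cvm_shift (F2 n) n) \<le>
            l2norm (\<lambda>t. cvm_shift (F n) n t - cvm_shift (F2 n) n t)"
          by (rule abs_le_D1[OF l2norm_diff_le]) (intro bdd_borel_cvm_shift D)+
        also have "(\<lambda>t. cvm_shift (F n) n t - cvm_shift (F2 n) n t) = (\<lambda>t. - cvm_shift (F1 n) n t)"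
          by (simp add: cvm_shift_def assms(8) fun_eq_iff algebra_simps)
        finally show ?thesis by (simp add: d_def l2norm_uminus)
      qed
      show ?case
      \<comment> \<open>For a bounded shift the comparison near the threshold applies; for a large
        one both rejection probabilities lie between \<open>1 - \<epsilon> / 2\<close> and
        1.\<close>
      proof (cases "l2norm (cvm_shift (F n) n) \<le> K")
        case True
        have "\<bar>reject_prob (F n) n (c n) - reject_prob (F2 n) n (c n)\<bar> \<le>
            \<epsilon> / 4 + 4 * (l2norm (cvm_shift (F n) n) / sqrt (real n)) / \<eta>\<^sup>2 + 16 * d n / \<eta>\<^sup>2"
          unfolding d_def
        proof (rule reject_prob_diff_le[OF D(1) D(3) D(2) assms(8)])
          show "stat_prob unif01 n (cvm_shift (F n) n) {sqrt (c n) - \<eta>..sqrt (c n) + \<eta>} \<le> \<epsilon> / 4"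
            using elim by (intro ac bdd_borel_cvm_shift D) auto
        qed (use elim \<eta> in \<open>auto simp: d_def\<close>)
        also have "4 * (l2norm (cvm_shift (F n) n) / sqrt (real n)) / \<eta>\<^sup>2 \<le> 4 * (K / sqrt (real n)) / \<eta>\<^sup>2"
          using True by (intro divide_right_mono mult_left_mono) auto
        finally show ?thesis using elim(1,2) \<epsilon> by linarith
      next
        case False
        have "reject_prob (F n) n (c n) \<ge> 1 - 1 / \<kappa>\<^sup>2"
          using False elim \<kappa> by (intro reject_prob_ge_far D) (auto simp: K_def)
        moreover have "reject_prob (F2 n) n (c n) \<ge> 1 - 1 / \<kappa>\<^sup>2"
          using False elim \<kappa> dF2 by (intro reject_prob_ge_far D) (auto simp: K_def)
        ultimately show ?thesis
          using reject_prob_le_1[OF D(1), of n n "c n"] reject_prob_le_1[OF D(3), of n n "c n"] \<kappa>(2) \<epsilon>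
          by linarith
      qed
    qed
  qed
  show "(\<lambda>n. type2 (F n) n (c n) - type2 (F2 n) n (c n)) \<longlonglongrightarrow> 0"
  proof (rule tendstoI)
    fix \<epsilon> :: real assume "\<epsilon> > 0"
    from ev[OF this] show "eventually (\<lambda>n. dist (type2 (F n) n (c n) - type2 (F2 n) n (c n)) 0 < \<epsilon>) sequentially"
      by eventually_elim (simp add: type2_def abs_minus_commute)
  qed
qed

end
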